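(* If $E\subset\mathbb{R}$ is $M$-relatively connected and $f:E\to\mathbb{R}^n$ is $\eta$-quasisymmetric, then $f$ extends to an $\eta'$-quasisymmetric embedding $F:\mathbb{R}\to\mathbb{R}^{n+n_0}$, where $n_0\in\mathbb{N}$ depends only on $M$ and $\eta$, while $\eta'$ depends only on $M$, $\eta$ and $n$.
   Context: Subsets of Euclidean spaces carry the Euclidean metric. $\mathbb{R}^n$ is identified with $\mathbb{R}^n\times\{0\}\subset\mathbb{R}^{n+n_0}$, so "$F$ extends $f$" means $F(x)=(f(x),0)$ for $x\in E$. Quasisymmetry: let $\eta:[0,\infty)\to[0,\infty)$ be a homeomorphism. A map $f:(X,d)\to(Y,d')$ between metric spaces, which is a homeomorphism onto its image, is $\eta$-quasisymmetric if for all $x,a,b\in X$ with $x\neq b$, $\frac{d'(f(x),f(a))}{d'(f(x),f(b))}\le\eta\left(\frac{d(x,a)}{d(x,b)}\right)$. Relative connectedness: a metric space $X$ is $M$-relatively connected, $M>1$, if for every $x\in X$ and $r>0$ with $\overline{B}(x,r)\neq X$, either $\overline{B}(x,r)=\{x\}$ or $\overline{B}(x,r)\setminus B(x,r/M)\neq\emptyset$. Here $B(x,r)$ and $\overline{B}(x,r)$ are the open ball $\{d(\cdot,x)<r\}$ and the closed ball $\{d(\cdot,x)\le r\}$ in $X$. A subset of $\mathbb{R}$ is regarded as a metric space in its own right. *)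

theory Defs
  imports "HOL-Analysis.Analysis"
begin

text \<open>
  \<open>\<real>\<^sup>n\<close> as a metric space, on the carrier of the library's \<^const>\<open>Euclidean_space\<close>: sequences
  vanishing from index \<open>n\<close> on. The dimension is thus a number, and
  \<open>\<real>\<^sup>n = \<real>\<^sup>n \<times> {0} \<subseteq> \<real>\<^bsup>n+k\<^esup>\<close> is a literal inclusion.
\<close>

definition euclidean_nspace :: "nat \<Rightarrow> (nat \<Rightarrow> real) metric" where
  "euclidean_nspace n =
     metric (topspace (Euclidean_space n), \<lambda>x y. L2_set (\<lambda>i. x i - y i) {..<n})"

lemma Metric_space_euclidean_nspace:
  "Metric_space (topspace (Euclidean_space n)) (\<lambda>x y. L2_set (\<lambda>i. x i - y i) {..<n})"
proof
  fix x y :: "nat \<Rightarrow> real"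
  show "L2_set (\<lambda>i. x i - y i) {..<n} = L2_set (\<lambda>i. y i - x i) {..<n}"
    by (simp add: L2_set_def power2_commute)
next
  fix x y :: "nat \<Rightarrow> real"
  assume "x \<in> topspace (Euclidean_space n)" "y \<in> topspace (Euclidean_space n)"
  then show "L2_set (\<lambda>i. x i - y i) {..<n} = 0 \<longleftrightarrow> x = y"
    by (simp add: L2_set_eq_0_iff topspace_Euclidean_space fun_eq_iff Ball_def)
      (metis not_less)
next
  fix x y z :: "nat \<Rightarrow> real"
  show "L2_set (\<lambda>i. x i - z i) {..<n} \<le> L2_set (\<lambda>i. x i - y i) {..<n} + L2_set (\<lambda>i. y i - z i) {..<n}"
    using L2_set_triangle_ineq [of "\<lambda>i. x i - y i" "\<lambda>i. y i - z i" "{..<n}"] by simp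
qed simp

lemma mspace_euclidean_nspace [simp]: "mspace (euclidean_nspace n) = {x. \<forall>i\<ge>n. x i = 0}"
  unfolding euclidean_nspace_def Metric_space.mspace_metric [OF Metric_space_euclidean_nspace]
  by (rule topspace_Euclidean_space)

lemma mdist_euclidean_nspace [simp]:
  "mdist (euclidean_nspace n) = (\<lambda>x y. L2_set (\<lambda>i. x i - y i) {..<n})"
  by (simp add: euclidean_nspace_def Metric_space.mdist_metric [OF Metric_space_euclidean_nspace])

lemma submetric_euclidean_nspace:
  assumes "x \<in> mspace (euclidean_nspace n)" "y \<in> mspace (euclidean_nspace n)"
  shows "x \<in> mspace (euclidean_nspace (n + k))"
    and "mdist (euclidean_nspace (n + k)) x y = mdist (euclidean_nspace n) x y"
proof -
  show "x \<in> mspace (euclidean_nspace (n + k))"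
    using assms by simp
  have "(\<Sum>i<n + k. (x i - y i)\<^sup>2) = (\<Sum>i<n. (x i - y i)\<^sup>2)"
    using assms by (intro sum.mono_neutral_right) auto
  then show "mdist (euclidean_nspace (n + k)) x y = mdist (euclidean_nspace n) x y"
    by (simp add: L2_set_def)
qed

text \<open>
  A homeomorphism of \<open>[0,\<infinity>)\<close>, represented by a total function whose values on
  negative reals are irrelevant.
\<close>

definition control_function :: "(real \<Rightarrow> real) \<Rightarrow> bool" where
  "control_function \<eta> \<longleftrightarrow> (\<exists>\<theta>. homeomorphism {0..} {0..} \<eta> \<theta>)"

text \<open>Only the values of \<open>f\<close> on \<open>mspace X\<close> matter.\<close>

definition quasisymmetric ::
    "(real \<Rightarrow> real) \<Rightarrow> 'a metric \<Rightarrow> 'b metric \<Rightarrow> ('a \<Rightarrow> 'b) \<Rightarrow> bool" where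
  "quasisymmetric \<eta> X Y f \<longleftrightarrow>
     f \<in> mspace X \<rightarrow> mspace Y \<and>
     embedding_map (mtopology_of X) (mtopology_of Y) f \<and>
     (\<forall>x\<in>mspace X. \<forall>a\<in>mspace X. \<forall>b\<in>mspace X. x \<noteq> b \<longrightarrow>
        mdist Y (f x) (f a) / mdist Y (f x) (f b) \<le> \<eta> (mdist X x a / mdist X x b))"

definition relatively_connected :: "real \<Rightarrow> 'a metric \<Rightarrow> bool" where
  "relatively_connected M X \<longleftrightarrow> M > 1 \<and>
     (\<forall>x\<in>mspace X. \<forall>r>0. mcball_of X x r \<noteq> mspace X \<longrightarrow>
        mcball_of X x r = {x} \<or> mcball_of X x r - mball_of X x (r / M) \<noteq> {})"

end

theory Submission
  imports Defs
begin

text \<open>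
  The distortion of a quasisymmetric map \<open>f\<close> on a relatively connected set \<open>E\<close> is described by a
  gauge: a number \<open>\<omega> x r\<close>, for \<open>x \<in> E\<close> and every \<open>r > 0\<close>, that stands for the size of the image of the
  ball of radius \<open>r\<close> around \<open>x\<close>. If \<open>E\<close> has points at distance about \<open>r\<close> from \<open>x\<close>, then \<open>\<omega> x r\<close> is the
  distance from \<open>f x\<close> to the image of such a point. Relative connectedness leaves two other cases only: \<open>r\<close>
  is smaller than the distance to all other points of \<open>E\<close>, or larger than the distance to all of them; there
  \<open>\<omega> x\<close> is continued linearly in \<open>r\<close> (\<open>qs_gauge_if_qs_bound\<close>). Since \<open>\<real>\<^sup>n\<close> is complete, \<open>f\<close> first
  extends to the closure of \<open>E\<close> (\<open>qs_bound_extends_to_closure\<close>), so \<open>E\<close> may be taken closed; then each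
  \<open>x\<close> has a distance \<open>\<delta> x\<close> to \<open>E\<close>, a nearest point (its foot), and, outside \<open>E\<close>, a gap containing it.
  
  The extension is \<open>F x = (g x, h x)\<close>. The part \<open>g x \<in> \<real>\<^sup>n\<close> is constant on the outer thirds of a gap,
  with the values of \<open>f\<close> at the ends, and affine in between. The part \<open>h x\<close> lives in \<open>K\<close> extra
  planes and lifts \<open>x\<close> off \<open>E\<close> to a height comparable with \<open>\<omega> (foot x) (\<delta> x)\<close>. At scale
  \<open>\<delta> x \<approx> 2\<^sup>k\<close> it turns in the plane with number \<open>k mod K\<close> with angular speed \<open>1 / (2 N 2\<^sup>k)\<close>. So two points
  at distance less than \<open>N \<delta> x\<close> have different angles if they are active at the same scale, lie in
  different planes if their scales are different but close, and otherwise one of the two heights is negligible because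
  scales that share a plane differ by a factor of at least \<open>2\<^sup>K\<close> (\<open>wave_separates\<close>). Points that are
  farther apart are separated by \<open>g\<close> already, because both are close to \<open>E\<close> relative to their
  distance (\<open>scale_at_le_far\<close>). Only \<open>N\<close> and \<open>K\<close> have to be large, depending on the gauge constants and
  hence on \<open>M\<close> and \<open>\<eta>\<close>; this gives \<open>n\<^sub>0 = 2 K\<close>.
  
  Altogether the distance of \<open>F x\<close> and \<open>F y\<close> is comparable with \<open>scale_at x \<bar>x - y\<bar>\<close>, the gauge carried over to
  arbitrary centres \<open>x\<close> (\<open>separation_upper\<close>, \<open>scale_at_le_separation\<close>). Quasisymmetry compares two
  distances from the same centre, so it follows from the growth \<open>scale_at_growth\<close> of this function in
  the radius.
\<close>

section \<open>Moduli\<close>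

text \<open>
  Control functions without the surjectivity: this class contains all control functions and is closed
  under sums, products, composition and scaling, so that distortion bounds can be computed freely. Adding
  the identity turns a modulus back into a control function.
\<close>

definition modulus :: "(real \<Rightarrow> real) \<Rightarrow> bool" where
  "modulus \<phi> \<longleftrightarrow> continuous_on {0..} \<phi> \<and> (\<forall>s\<ge>0. \<forall>t\<ge>s. \<phi> s \<le> \<phi> t) \<and> \<phi> 0 = 0"

lemma modulusI:
  "continuous_on {0..} \<phi> \<Longrightarrow> (\<And>s t. 0 \<le> s \<Longrightarrow> s \<le> t \<Longrightarrow> \<phi> s \<le> \<phi> t) \<Longrightarrow> \<phi> 0 = 0 \<Longrightarrow> modulus \<phi>"
  by (simp add: modulus_def)

lemma modulus_mono: "modulus \<phi> \<Longrightarrow> 0 \<le> s \<Longrightarrow> s \<le> t \<Longrightarrow> \<phi> s \<le> \<phi> t"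
  by (auto simp: modulus_def)

lemma modulus_nonneg: "modulus \<phi> \<Longrightarrow> 0 \<le> t \<Longrightarrow> 0 \<le> \<phi> t"
  using modulus_mono [of \<phi> 0 t] by (simp add: modulus_def)

lemma modulus_zero: "modulus \<phi> \<Longrightarrow> \<phi> 0 = 0"
  by (simp add: modulus_def)

lemma modulus_small:
  assumes "modulus \<phi>" "0 < \<epsilon>"
  obtains \<delta> where "0 < \<delta>" "\<phi> \<delta> \<le> \<epsilon>"
proof -
  have "continuous_on {0..} \<phi>" "\<phi> 0 = 0"
    using assms by (auto simp: modulus_def)
  then obtain d where d: "d > 0" "\<And>t. t \<in> {0..} \<Longrightarrow> dist t 0 < d \<Longrightarrow> dist (\<phi> t) (\<phi> 0) < \<epsilon>"
    using \<open>0 < \<epsilon>\<close> unfolding continuous_on_iff by (metis atLeast_iff order_refl)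
  from d(2) [of "d / 2"] d(1) \<open>\<phi> 0 = 0\<close> have "\<phi> (d / 2) \<le> \<epsilon>"
    by (auto simp: dist_real_def)
  with d(1) that [of "d / 2"] show thesis
    by simp
qed

lemma modulus_add:
  assumes "modulus \<phi>" "modulus \<psi>"
  shows "modulus (\<lambda>t. \<phi> t + \<psi> t)"
proof (rule modulusI)
  show "continuous_on {0..} (\<lambda>t. \<phi> t + \<psi> t)"
    using assms unfolding modulus_def by (intro continuous_on_add) blast+
qed (use assms in \<open>auto simp: modulus_def intro: add_mono\<close>)

lemma modulus_mult:
  assumes "modulus \<phi>" "modulus \<psi>"
  shows "modulus (\<lambda>t. \<phi> t * \<psi> t)"
proof (rule modulusI)
  show "continuous_on {0..} (\<lambda>t. \<phi> t * \<psi> t)"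
    using assms unfolding modulus_def by (intro continuous_on_mult) blast+
qed (use assms modulus_nonneg [OF assms(1)] modulus_nonneg [OF assms(2)] in \<open>auto simp: modulus_def intro!: mult_mono\<close>)

lemma modulus_cmult:
  assumes "modulus \<phi>" "0 \<le> c"
  shows "modulus (\<lambda>t. c * \<phi> t)"
proof (rule modulusI)
  show "continuous_on {0..} (\<lambda>t. c * \<phi> t)"
    using assms unfolding modulus_def by (intro continuous_on_mult continuous_on_const) blast+
qed (use assms in \<open>auto simp: modulus_def intro: mult_left_mono\<close>)

lemma modulus_compose:
  assumes "modulus \<phi>" "modulus \<psi>"
  shows "modulus (\<lambda>t. \<phi> (\<psi> t))"
proof -
  have "continuous_on {0..} (\<lambda>t. \<phi> (\<psi> t))"
    by (rule continuous_on_compose2 [of "{0..}" \<phi>])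
      (use assms modulus_nonneg [OF assms(2)] in \<open>auto simp: modulus_def\<close>)
  then show ?thesis
    using assms modulus_nonneg [OF assms(2)] by (auto simp: modulus_def)
qed

lemma modulus_ident: "modulus (\<lambda>t. t)"
  by (rule modulusI) (auto intro: continuous_on_id)

lemma modulus_sqrt: "modulus sqrt"
  by (rule modulusI) (auto intro: continuous_on_real_sqrt continuous_on_id)

lemma modulus_scale: "modulus \<phi> \<Longrightarrow> 0 \<le> c \<Longrightarrow> modulus (\<lambda>t. \<phi> (c * t))"
  by (rule modulus_compose [OF _ modulus_cmult [OF modulus_ident]])

text \<open>
  A homeomorphism of \<open>[0,\<infinity>)\<close> is monotone by the intermediate value theorem; it cannot be decreasing, nor
  start at a positive value, because \<open>0\<close> and arbitrarily large numbers are values.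
\<close>

lemma modulus_control_function:
  assumes "control_function \<eta>"
  shows "modulus \<eta>"
proof -
  obtain \<theta> where hom: "homeomorphism {0..} {0..} \<eta> \<theta>"
    using assms by (auto simp: control_function_def)
  then have cont: "continuous_on {0..} \<eta>" and im: "\<eta> ` {0..} = {0..}"
    by (auto simp: homeomorphism_def)
  have inj: "inj_on \<eta> {0..}"
    using homeomorphism_apply1 [OF hom] by (rule inj_on_inverseI)
  have trichotomy: "(\<eta> a < \<eta> b \<and> \<eta> b < \<eta> c) \<or> (\<eta> c < \<eta> b \<and> \<eta> b < \<eta> a)"
    if "0 \<le> a" "a < b" "b < c" for a b c
    using that
    by (intro continuous_inj_imp_mono) (auto intro: continuous_on_subset [OF cont] inj_on_subset [OF inj])
  have nonneg: "0 \<le> \<eta> t" if "0 \<le> t" for t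
    using imageI [of t "{0..}" \<eta>] im that by simp
  have zero: "\<eta> 0 = 0"
  proof (rule ccontr)
    assume "\<eta> 0 \<noteq> 0"
    then have pos: "0 < \<eta> 0"
      using nonneg [of 0] by simp
    obtain z where z: "0 \<le> z" "\<eta> z = 0"
      using im by (metis atLeast_iff imageE order_refl)
    obtain w where w: "0 \<le> w" "\<eta> w = \<eta> 0 + 1"
      using im pos by (metis atLeast_iff imageE add_nonneg_nonneg less_imp_le zero_le_one)
    have "z \<noteq> 0" "w \<noteq> 0" "z \<noteq> w"
      using z w pos by auto
    then consider "0 < z" "z < w" | "0 < w" "w < z"
      using z w by linarith
    then show False
      using trichotomy [of 0 z w] trichotomy [of 0 w z] z w pos by cases auto
  qed
  have "\<eta> s \<le> \<eta> t" if "0 \<le> s" "s \<le> t" for s t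
  proof (cases "0 < s \<and> s < t")
    case True
    then show ?thesis
      using trichotomy [of 0 s t] nonneg [of t] zero by auto
  next
    case False
    then have "s = 0 \<or> s = t"
      using that by auto
    then show ?thesis
      using nonneg [of t] zero that by auto
  qed
  then show ?thesis
    using cont zero by (auto simp: modulus_def)
qed

lemma control_function_add_modulus:
  assumes "modulus \<phi>"
  shows "control_function (\<lambda>t. t + \<phi> t)"
proof -
  let ?\<eta> = "\<lambda>t. t + \<phi> t"
  have cont: "continuous_on {0..} ?\<eta>" and zero: "?\<eta> 0 = 0"
    using assms by (auto simp: modulus_def intro!: continuous_on_add continuous_on_id)
  have less: "?\<eta> s < ?\<eta> t" if "0 \<le> s" "s < t" for s t
    using modulus_mono [OF assms, of s t] that by simp
  have inj: "inj_on ?\<eta> {0..}"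
    unfolding inj_on_def by (metis less atLeast_iff linorder_neqE less_irrefl)
  have im: "?\<eta> ` {0..} = {0..}"
  proof
    show "?\<eta> ` {0..} \<subseteq> {0..}"
      by (auto intro!: add_nonneg_nonneg modulus_nonneg [OF assms])
    show "{0..} \<subseteq> ?\<eta> ` {0..}"
    proof
      fix y :: real assume "y \<in> {0..}"
      then have y: "0 \<le> y" by simp
      have "\<exists>x\<ge>0. x \<le> y \<and> ?\<eta> x = y"
        using y zero modulus_nonneg [OF assms y]
        by (intro IVT') (auto intro: continuous_on_subset [OF cont])
      then obtain x where "0 \<le> x" "y = ?\<eta> x" by blast
      then show "y \<in> ?\<eta> ` {0..}"
        by (intro image_eqI [of _ _ x]) auto
    qed
  qed
  have "path_connected ({0..} :: real set)"
    by (simp add: convex_imp_path_connected)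
  then show ?thesis
    using injective_into_1d_eq_homeomorphism [OF cont] inj im
    by (auto simp: control_function_def)
qed

section \<open>Quasisymmetry as a family of inequalities\<close>

abbreviation ndist :: "nat \<Rightarrow> (nat \<Rightarrow> real) \<Rightarrow> (nat \<Rightarrow> real) \<Rightarrow> real" where
  "ndist n u v \<equiv> L2_set (\<lambda>i. u i - v i) {..<n}"

lemma ndist_triangle: "ndist n u w \<le> ndist n u v + ndist n v w"
  using L2_set_triangle_ineq [of "\<lambda>i. u i - v i" "\<lambda>i. v i - w i" "{..<n}"] by simp

lemma ndist_commute: "ndist n u v = ndist n v u"
  by (simp add: L2_set_def power2_commute)

text \<open>
  Quasisymmetry in multiplied-out form. The positivity stands for injectivity.
\<close>

definition qs_bound :: "(real \<Rightarrow> real) \<Rightarrow> nat \<Rightarrow> real set \<Rightarrow> (real \<Rightarrow> nat \<Rightarrow> real) \<Rightarrow> bool" where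
  "qs_bound \<eta> n E f \<longleftrightarrow> (\<forall>x\<in>E. \<forall>a\<in>E. \<forall>b\<in>E. x \<noteq> b \<longrightarrow>
     0 < ndist n (f x) (f b) \<and>
     ndist n (f x) (f a) \<le> \<eta> (\<bar>x - a\<bar> / \<bar>x - b\<bar>) * ndist n (f x) (f b))"

lemma qs_boundD:
  assumes "qs_bound \<eta> n E f" "x \<in> E" "b \<in> E" "x \<noteq> b"
  shows "0 < ndist n (f x) (f b)"
    and "a \<in> E \<Longrightarrow> ndist n (f x) (f a) \<le> \<eta> (\<bar>x - a\<bar> / \<bar>x - b\<bar>) * ndist n (f x) (f b)"
  using assms unfolding qs_bound_def by blast+

lemma quasisymmetric_imp_qs_bound:
  assumes "quasisymmetric \<eta> (submetric euclidean_metric E) (euclidean_nspace n) f"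
  shows "qs_bound \<eta> n E f" and "\<And>x i. x \<in> E \<Longrightarrow> n \<le> i \<Longrightarrow> f x i = 0"
proof -
  let ?X = "submetric euclidean_metric E" and ?Y = "euclidean_nspace n"
  from assms have into: "f \<in> E \<rightarrow> mspace ?Y"
    and emb: "embedding_map (mtopology_of ?X) (mtopology_of ?Y) f"
    and qs: "\<And>x a b. x \<in> E \<Longrightarrow> a \<in> E \<Longrightarrow> b \<in> E \<Longrightarrow> x \<noteq> b \<Longrightarrow>
        mdist ?Y (f x) (f a) / mdist ?Y (f x) (f b) \<le> \<eta> (dist x a / dist x b)"
    by (simp_all add: quasisymmetric_def)
  have inj: "inj_on f E"
    using emb by (auto simp: embedding_map_def dest: homeomorphic_imp_injective_map)
  have pos: "0 < ndist n (f x) (f b)" if "x \<in> E" "b \<in> E" "x \<noteq> b" for x b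
  proof -
    interpret Metric_space "mspace ?Y" "mdist ?Y"
      by (rule Metric_space_mspace_mdist)
    have "f x \<noteq> f b" "f x \<in> mspace ?Y" "f b \<in> mspace ?Y"
      using inj that into by (auto simp: inj_on_def)
    then have "0 < mdist ?Y (f x) (f b)"
      using mdist_pos_less by blast
    then show ?thesis by simp
  qed
  show "qs_bound \<eta> n E f"
    unfolding qs_bound_def
  proof (intro ballI impI conjI)
    fix x a b assume "x \<in> E" "a \<in> E" "b \<in> E" "x \<noteq> b"
    then show "0 < ndist n (f x) (f b)"
      "ndist n (f x) (f a) \<le> \<eta> (\<bar>x - a\<bar> / \<bar>x - b\<bar>) * ndist n (f x) (f b)"
      using pos qs [of x a b] by (auto simp: dist_real_def pos_divide_le_eq)
  qed
  show "f x i = 0" if "x \<in> E" "n \<le> i" for x i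
    using into that by auto
qed

text \<open>
  The inequalities with \<open>b = x + 1\<close> bound the distance of \<open>F x\<close> and \<open>F a\<close> by a multiple of \<open>\<eta> \<bar>x - a\<bar>\<close>,
  which gives continuity. With \<open>a = x + 1\<close> and \<open>\<bar>x - b\<bar> \<ge> \<epsilon>\<close> they bound the distance of \<open>F x\<close> and \<open>F b\<close> from
  below, which gives continuity of the inverse.
\<close>

lemma quasisymmetric_if_qs_bound:
  assumes \<eta>: "modulus \<eta>" and qs: "qs_bound \<eta> n UNIV F"
    and supp: "\<And>x i. n \<le> i \<Longrightarrow> F x i = 0"
  shows "quasisymmetric \<eta> euclidean_metric (euclidean_nspace n) F"
proof -
  let ?Y = "euclidean_nspace n" and ?d = "ndist n"
  have pos: "0 < ?d (F x) (F b)" if "x \<noteq> b" for x b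
    using qs_boundD(1) [OF qs] that by blast
  have bound: "?d (F x) (F a) \<le> \<eta> (\<bar>x - a\<bar> / \<bar>x - b\<bar>) * ?d (F x) (F b)" if "x \<noteq> b" for x a b
    using qs_boundD(2) [OF qs] that by blast
  have inj: "inj F"
  proof (rule injI, rule ccontr)
    fix x y assume "F x = F y" "x \<noteq> y"
    then show False
      using pos [of x y] by (simp add: L2_set_def)
  qed
  have cont_iff: "continuous_map (mtopology_of m) (mtopology_of m') h \<longleftrightarrow>
      h ` mspace m \<subseteq> mspace m' \<and> (\<forall>a\<in>mspace m. \<forall>\<epsilon>>0. \<exists>\<delta>>0. \<forall>x.
         x \<in> mspace m \<and> mdist m a x < \<delta> \<longrightarrow> mdist m' (h a) (h x) < \<epsilon>)"
    for m :: "'c metric" and m' :: "'d metric" and h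
    unfolding mtopology_of_def
    by (rule Metric_space.metric_continuous_map) simp_all
  have cont: "continuous_map (mtopology_of euclidean_metric) (mtopology_of ?Y) F"
    unfolding cont_iff
  proof (intro conjI ballI allI impI)
    show "F ` mspace euclidean_metric \<subseteq> mspace ?Y"
      using supp by auto
    fix a \<epsilon> :: real assume "\<epsilon> > 0"
    let ?D = "?d (F a) (F (a + 1))"
    have D: "0 < ?D" by (rule pos) simp
    obtain \<delta> where \<delta>: "0 < \<delta>" "\<eta> \<delta> \<le> \<epsilon> / (2 * ?D)"
      using modulus_small [OF \<eta>, of "\<epsilon> / (2 * ?D)"] D \<open>\<epsilon> > 0\<close> by auto
    show "\<exists>\<delta>>0. \<forall>x. x \<in> mspace euclidean_metric \<and> mdist euclidean_metric a x < \<delta>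
            \<longrightarrow> mdist ?Y (F a) (F x) < \<epsilon>"
    proof (intro exI conjI allI impI)
      fix x assume "x \<in> mspace euclidean_metric \<and> mdist euclidean_metric a x < \<delta>"
      then have "\<bar>a - x\<bar> < \<delta>" by (simp add: dist_real_def)
      then have "\<eta> \<bar>a - x\<bar> * ?D \<le> (\<epsilon> / (2 * ?D)) * ?D"
        using modulus_mono [OF \<eta>, of "\<bar>a - x\<bar>" \<delta>] \<delta>(2) D by (intro mult_right_mono) auto
      then show "mdist ?Y (F a) (F x) < \<epsilon>"
        using bound [of a "a + 1" x] D \<open>\<epsilon> > 0\<close> by simp
    qed (rule \<delta>(1))
  qed
  let ?S = "submetric ?Y (range F)"
  have S: "mspace ?S = range F"
    using supp by auto
  have cont_inv: "continuous_map (mtopology_of ?S) (mtopology_of euclidean_metric) (inv F)"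
    unfolding cont_iff S
  proof (intro conjI ballI allI impI)
    fix y and \<epsilon> :: real assume "y \<in> range F" "\<epsilon> > 0"
    then obtain x where x: "y = F x" by auto
    let ?D = "?d (F x) (F (x + 1))"
    have D: "0 < ?D" by (rule pos) simp
    have nn: "0 \<le> \<eta> (1 / \<epsilon>)"
      using modulus_nonneg [OF \<eta>] \<open>\<epsilon> > 0\<close> by simp
    show "\<exists>\<delta>>0. \<forall>z. z \<in> range F \<and> mdist ?S y z < \<delta> \<longrightarrow>
            mdist euclidean_metric (inv F y) (inv F z) < \<epsilon>"
    proof (intro exI conjI allI impI)
      show "0 < ?D / (\<eta> (1 / \<epsilon>) + 1)"
        using D nn by simp
      fix z assume "z \<in> range F \<and> mdist ?S y z < ?D / (\<eta> (1 / \<epsilon>) + 1)"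
      then obtain w where w: "z = F w" and less: "?d (F x) (F w) < ?D / (\<eta> (1 / \<epsilon>) + 1)"
        using x by auto
      have "\<bar>x - w\<bar> < \<epsilon>"
      proof (rule ccontr)
        assume "\<not> \<bar>x - w\<bar> < \<epsilon>"
        then have far: "\<epsilon> \<le> \<bar>x - w\<bar>" "x \<noteq> w"
          using \<open>\<epsilon> > 0\<close> by auto
        have "?D \<le> \<eta> (1 / \<bar>x - w\<bar>) * ?d (F x) (F w)"
          using bound [OF far(2), of "x + 1"] by simp
        also have "\<dots> \<le> (\<eta> (1 / \<epsilon>) + 1) * ?d (F x) (F w)"
          using modulus_mono [OF \<eta>, of "1 / \<bar>x - w\<bar>" "1 / \<epsilon>"] far \<open>\<epsilon> > 0\<close>
          by (intro mult_right_mono) (auto simp: frac_le)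
        also have "\<dots> < ?D"
          using less nn by (simp add: pos_less_divide_eq mult.commute)
        finally show False by simp
      qed
      then show "mdist euclidean_metric (inv F y) (inv F z) < \<epsilon>"
        using inj x w by (simp add: dist_real_def)
    qed
  qed simp
  have "homeomorphic_maps (mtopology_of euclidean_metric) (mtopology_of ?S) F (inv F)"
    unfolding homeomorphic_maps_def
    using cont cont_inv inj S
    by (auto simp: mtopology_of_submetric continuous_map_in_subtopology)
  then have "embedding_map (mtopology_of euclidean_metric) (mtopology_of ?Y) F"
    unfolding embedding_map_def
    by (auto simp: homeomorphic_map_maps mtopology_of_submetric)
  moreover have "?d (F x) (F a) / ?d (F x) (F b) \<le> \<eta> (\<bar>x - a\<bar> / \<bar>x - b\<bar>)" if "x \<noteq> b" for x a b
    using bound [OF that] pos [OF that] by (simp add: pos_divide_le_eq)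
  ultimately show ?thesis
    using supp by (simp add: quasisymmetric_def dist_real_def)
qed

section \<open>Relative connectedness and closures\<close>

text \<open>
  Relative connectedness of a subset of the line, with the alternatives about balls spelled out as
  alternatives about points. All points of \<open>E\<close> other than \<open>x\<close> lie outside the ball, or all lie inside, or
  some point lies in the shell.
\<close>

definition annular :: "real \<Rightarrow> real set \<Rightarrow> bool" where
  "annular M E \<longleftrightarrow> (\<forall>x\<in>E. \<forall>r>0.
     (\<exists>y\<in>E. r / M \<le> \<bar>x - y\<bar> \<and> \<bar>x - y\<bar> \<le> r) \<or>
     (\<forall>y\<in>E. y \<noteq> x \<longrightarrow> r < \<bar>x - y\<bar>) \<or>
     (\<forall>y\<in>E. \<bar>x - y\<bar> \<le> r))"

lemma annular_cases:
  assumes "annular M E" "x \<in> E" "0 < r"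
  obtains (shell) y where "y \<in> E" "r / M \<le> \<bar>x - y\<bar>" "\<bar>x - y\<bar> \<le> r"
    | (beyond) "\<And>y. y \<in> E \<Longrightarrow> y \<noteq> x \<Longrightarrow> r < \<bar>x - y\<bar>"
    | (within) "\<And>y. y \<in> E \<Longrightarrow> \<bar>x - y\<bar> \<le> r"
  using assms unfolding annular_def by blast

lemma relatively_connected_imp_annular:
  assumes "relatively_connected M (submetric euclidean_metric E)"
  shows "annular M E"
  unfolding annular_def
proof (intro ballI allI impI)
  fix x r :: real
  assume x: "x \<in> E" and r: "0 < r"
  let ?X = "submetric euclidean_metric E"
  have "mcball_of ?X x r = mspace ?X \<or> mcball_of ?X x r = {x} \<or>
      mcball_of ?X x r - mball_of ?X x (r / M) \<noteq> {}"
    using assms x r by (auto simp: relatively_connected_def)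
  then consider "mcball_of ?X x r = E" | "mcball_of ?X x r = {x}"
    | "mcball_of ?X x r - mball_of ?X x (r / M) \<noteq> {}"
    by auto
  then show "(\<exists>y\<in>E. r / M \<le> \<bar>x - y\<bar> \<and> \<bar>x - y\<bar> \<le> r) \<or>
     (\<forall>y\<in>E. y \<noteq> x \<longrightarrow> r < \<bar>x - y\<bar>) \<or> (\<forall>y\<in>E. \<bar>x - y\<bar> \<le> r)"
  proof cases
    case 1
    then have "\<bar>x - y\<bar> \<le> r" if "y \<in> E" for y
      using that in_mcball_of [of y ?X x r] by (simp add: dist_real_def)
    then show ?thesis by blast
  next
    case 2
    have "r < \<bar>x - y\<bar>" if "y \<in> E" "y \<noteq> x" for y
    proof (rule ccontr)
      assume "\<not> r < \<bar>x - y\<bar>"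
      then have "y \<in> mcball_of ?X x r"
        using that x by (simp add: dist_real_def)
      with 2 that show False by simp
    qed
    then show ?thesis by blast
  next
    case 3
    then obtain y where "y \<in> mcball_of ?X x r" "y \<notin> mball_of ?X x (r / M)"
      by blast
    then have "y \<in> E" "r / M \<le> \<bar>x - y\<bar>" "\<bar>x - y\<bar> \<le> r"
      using x by (auto simp: dist_real_def)
    then show ?thesis by blast
  qed
qed

text \<open>
  A point \<open>y \<noteq> x\<close> at distance exactly \<open>r\<close> is in the shell itself. Otherwise \<open>x\<close>, a point inside and a point
  outside the ball are approximated from \<open>E\<close>. If the approximation is fine compared with \<open>r / M\<close> and with
  the distances of the two points to the sphere and to \<open>x\<close>, then the shell condition applies at the approximating centre and a slightly smaller radius;
  doubling \<open>M\<close> absorbs the errors.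
\<close>

lemma annular_closure:
  assumes ann: "annular M E" and M: "1 \<le> M"
  shows "annular (2 * M) (closure E)"
  unfolding annular_def
proof (intro ballI allI impI)
  fix x r :: real
  assume x: "x \<in> closure E" and r: "0 < r"
  have approx: "\<exists>z'\<in>E. \<bar>z' - z\<bar> < \<epsilon>" if "z \<in> closure E" "0 < \<epsilon>" for z \<epsilon>
    using that by (auto simp: closure_approachable dist_real_def)
  have "\<exists>z\<in>closure E. r / (2 * M) \<le> \<bar>x - z\<bar> \<and> \<bar>x - z\<bar> \<le> r"
    if y: "y \<in> closure E" "y \<noteq> x" "\<bar>x - y\<bar> \<le> r" and w: "w \<in> closure E" "r < \<bar>x - w\<bar>" for y w
  proof (cases "\<bar>x - y\<bar> = r")
    case True
    have "r / (2 * M) \<le> r"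
      using M r by (simp add: divide_le_eq)
    with True y show ?thesis by blast
  next
    case False
    define \<epsilon> where "\<epsilon> = Min {\<bar>x - y\<bar> / 4, (r - \<bar>x - y\<bar>) / 4, \<bar>x - w\<bar> - r, r / (4 * M)}"
    have pos: "0 < \<epsilon>"
      using y w False M r by (auto simp: \<epsilon>_def)
    have le: "\<epsilon> \<le> \<bar>x - y\<bar> / 4" "\<epsilon> \<le> (r - \<bar>x - y\<bar>) / 4"
      "\<epsilon> \<le> \<bar>x - w\<bar> - r" "\<epsilon> \<le> r / (4 * M)"
      unfolding \<epsilon>_def by (rule Min_le; simp)+
    obtain x' y' w' where x': "x' \<in> E" "\<bar>x' - x\<bar> < \<epsilon>" and y': "y' \<in> E" "\<bar>y' - y\<bar> < \<epsilon>"
      and w': "w' \<in> E" "\<bar>w' - w\<bar> < \<epsilon>"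
      using approx [OF x pos] approx [OF y(1) pos] approx [OF w(1) pos] by blast
    have s: "0 < r - \<epsilon>"
      using le(2) r by argo
    have "y' \<noteq> x'"
      using le(1) x'(2) y'(2) pos by argo
    moreover have "\<bar>x' - y'\<bar> \<le> r - \<epsilon>"
      using le(2) x'(2) y'(2) pos by argo
    moreover have "r - \<epsilon> < \<bar>x' - w'\<bar>"
      using le(3) x'(2) w'(2) by argo
    ultimately obtain z where z: "z \<in> E" "(r - \<epsilon>) / M \<le> \<bar>x' - z\<bar>" "\<bar>x' - z\<bar> \<le> r - \<epsilon>"
      using annular_cases [OF ann x'(1) s] y'(1) w'(1) by (metis not_le)
    have "\<epsilon> / M \<le> \<epsilon>"
      using M pos by (simp add: divide_le_eq)
    moreover have "(r - \<epsilon>) / M = 4 * (r / (4 * M)) - \<epsilon> / M" "r / (2 * M) = 2 * (r / (4 * M))"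
      using M by (auto simp: diff_divide_distrib)
    ultimately have "r / (2 * M) \<le> \<bar>x - z\<bar>"
      using le(4) x'(2) z(2) by linarith
    moreover have "\<bar>x - z\<bar> \<le> r"
      using x'(2) z(3) by linarith
    ultimately show ?thesis
      using z(1) closure_subset by blast
  qed
  then show "(\<exists>y\<in>closure E. r / (2 * M) \<le> \<bar>x - y\<bar> \<and> \<bar>x - y\<bar> \<le> r) \<or>
     (\<forall>y\<in>closure E. y \<noteq> x \<longrightarrow> r < \<bar>x - y\<bar>) \<or> (\<forall>y\<in>closure E. \<bar>x - y\<bar> \<le> r)"
    by (meson not_le)
qed

lemma abs_coord_le_ndist: "i < n \<Longrightarrow> \<bar>u i - v i\<bar> \<le> ndist n u v"
  using member_le_L2_set [of "{..<n}" i "\<lambda>i. \<bar>u i - v i\<bar>"] by (simp add: L2_set_def)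

text \<open>
  Let \<open>\<sigma>\<close> be a Cauchy sequence in \<open>E\<close> and \<open>b \<in> E\<close> a point that is not its limit. The images stay within
  bounded distance \<open>B\<close> of \<open>f b\<close>, and \<open>\<sigma> k\<close> keeps a distance \<open>d\<close> from \<open>b\<close>, so the distance of the
  images of \<open>\<sigma> k\<close> and \<open>\<sigma> l\<close> is at most \<open>\<eta> (\<bar>\<sigma> k - \<sigma> l\<bar> / d) * B\<close>. For the bound \<open>B\<close> a second point \<open>a\<close> of \<open>E\<close>
  is used as the unit of length at \<open>b\<close>.
\<close>

lemma qs_bound_Cauchy_continuous:
  assumes \<eta>: "modulus \<eta>" and qs: "qs_bound \<eta> n E f"
    and two: "a\<^sub>0 \<in> E" "b\<^sub>0 \<in> E" "a\<^sub>0 \<noteq> b\<^sub>0" and i: "i < n"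
  shows "Cauchy_continuous_on E (\<lambda>x. f x i)"
  unfolding Cauchy_continuous_on_def
proof (intro allI impI)
  fix \<sigma> :: "nat \<Rightarrow> real"
  assume "Cauchy \<sigma>" "range \<sigma> \<subseteq> E"
  then have cauchy: "Cauchy \<sigma>" and \<sigma>: "\<And>k. \<sigma> k \<in> E"
    by auto
  then obtain x where x: "\<sigma> \<longlonglongrightarrow> x"
    using Cauchy_convergent convergent_def by blast
  obtain a b where b: "a \<in> E" "b \<in> E" "a \<noteq> b" "b \<noteq> x"
    using two by (cases "b\<^sub>0 = x") auto
  define d where "d = \<bar>x - b\<bar> / 2"
  have d: "0 < d"
    using b by (simp add: d_def)
  define B where "B = \<eta> (3 * d / \<bar>b - a\<bar>) * ndist n (f b) (f a) + 1"
  have "0 \<le> \<eta> (3 * d / \<bar>b - a\<bar>)"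
    using modulus_nonneg [OF \<eta>] d by simp
  then have B: "0 < B"
    by (simp add: B_def add_nonneg_pos)
  obtain N where N: "\<And>k. N \<le> k \<Longrightarrow> \<bar>\<sigma> k - x\<bar> < d"
    using x d unfolding LIMSEQ_def dist_real_def by blast
  have base: "d \<le> \<bar>\<sigma> k - b\<bar> \<and> ndist n (f (\<sigma> k)) (f b) \<le> B" if "N \<le> k" for k
  proof
    have *: "d \<le> \<bar>\<sigma> k - b\<bar>" "\<bar>b - \<sigma> k\<bar> \<le> 3 * d"
      using N [OF that] unfolding d_def by argo+
    show "d \<le> \<bar>\<sigma> k - b\<bar>" by (rule *)
    have "ndist n (f b) (f (\<sigma> k)) \<le> \<eta> (\<bar>b - \<sigma> k\<bar> / \<bar>b - a\<bar>) * ndist n (f b) (f a)"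
      using qs_boundD(2) [OF qs, of b a "\<sigma> k"] b \<sigma> by auto
    also have "\<dots> \<le> \<eta> (3 * d / \<bar>b - a\<bar>) * ndist n (f b) (f a)"
      using *(2) by (intro mult_right_mono modulus_mono [OF \<eta>] divide_right_mono) auto
    finally show "ndist n (f (\<sigma> k)) (f b) \<le> B"
      by (simp add: B_def ndist_commute)
  qed
  show "Cauchy ((\<lambda>x. f x i) \<circ> \<sigma>)"
  proof (rule metric_CauchyI)
    fix e :: real assume e: "0 < e"
    obtain \<delta> where \<delta>: "0 < \<delta>" "\<eta> \<delta> \<le> e / (2 * B)"
      using modulus_small [OF \<eta>, of "e / (2 * B)"] e B by auto
    obtain K where K: "\<And>k l. K \<le> k \<Longrightarrow> K \<le> l \<Longrightarrow> \<bar>\<sigma> k - \<sigma> l\<bar> < \<delta> * d"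
      using metric_CauchyD [OF cauchy, of "\<delta> * d"] \<delta>(1) d by (auto simp: dist_real_def)
    show "\<exists>M. \<forall>k\<ge>M. \<forall>l\<ge>M. dist (((\<lambda>x. f x i) \<circ> \<sigma>) k) (((\<lambda>x. f x i) \<circ> \<sigma>) l) < e"
    proof (intro exI allI impI)
      fix k l assume k: "max N K \<le> k" and l: "max N K \<le> l"
      have "\<bar>\<sigma> k - \<sigma> l\<bar> / \<bar>\<sigma> k - b\<bar> \<le> \<delta> * d / d"
        using K [of k l] base [of k] k l d by (intro frac_le) auto
      then have q: "\<bar>\<sigma> k - \<sigma> l\<bar> / \<bar>\<sigma> k - b\<bar> \<le> \<delta>"
        using d by simp
      have ne: "\<sigma> k \<noteq> b"
        using base [of k] k d by auto
      have "\<bar>f (\<sigma> k) i - f (\<sigma> l) i\<bar> \<le> ndist n (f (\<sigma> k)) (f (\<sigma> l))"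
        by (rule abs_coord_le_ndist [OF i])
      also have "\<dots> \<le> \<eta> (\<bar>\<sigma> k - \<sigma> l\<bar> / \<bar>\<sigma> k - b\<bar>) * ndist n (f (\<sigma> k)) (f b)"
        using qs_boundD(2) [OF qs \<sigma> b(2) ne \<sigma>] .
      also have "\<dots> \<le> e / (2 * B) * B"
        using modulus_mono [OF \<eta> _ q] \<delta>(2) base [of k] k e B
        by (intro mult_mono) auto
      also have "\<dots> < e"
        using B e by simp
      finally show "dist (((\<lambda>x. f x i) \<circ> \<sigma>) k) (((\<lambda>x. f x i) \<circ> \<sigma>) l) < e"
        by (simp add: dist_real_def)
    qed
  qed
qed

lemma tendsto_ndist:
  assumes "\<And>i. i < n \<Longrightarrow> (\<lambda>k. u k i) \<longlonglongrightarrow> p i" "\<And>i. i < n \<Longrightarrow> (\<lambda>k. v k i) \<longlonglongrightarrow> q i"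
  shows "(\<lambda>k. ndist n (u k) (v k)) \<longlonglongrightarrow> ndist n p q"
  unfolding L2_set_def using assms by (auto intro!: tendsto_real_sqrt tendsto_sum tendsto_power tendsto_diff)

text \<open>
  Coordinatewise extension by Cauchy continuity; the inequalities pass to the limit because \<open>\<eta>\<close> is
  continuous. If two distinct points of the closure had the same image, then the inequalities would make
  the extension constant, but \<open>f\<close> separates \<open>a\<^sub>0\<close> and \<open>b\<^sub>0\<close>.
\<close>

lemma qs_bound_extends_to_closure:
  assumes \<eta>: "modulus \<eta>" and qs: "qs_bound \<eta> n E f"
    and supp: "\<And>x i. x \<in> E \<Longrightarrow> n \<le> i \<Longrightarrow> f x i = 0"
    and two: "a\<^sub>0 \<in> E" "b\<^sub>0 \<in> E" "a\<^sub>0 \<noteq> b\<^sub>0"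
  obtains g where "\<And>x. x \<in> E \<Longrightarrow> g x = f x" "qs_bound \<eta> n (closure E) g"
    "\<And>x i. n \<le> i \<Longrightarrow> g x i = 0"
proof -
  have "\<exists>G. continuous_on (closure E) G \<and> (\<forall>x\<in>E. G x = f x i)" if "i < n" for i
  proof -
    have "Cauchy_continuous_map (submetric euclidean_metric E) euclidean_metric (\<lambda>x. f x i)"
      using qs_bound_Cauchy_continuous [OF \<eta> qs two that] by simp
    moreover have "mcomplete_of (euclidean_metric :: real metric)"
      by (simp add: mcomplete_of_def complete_UNIV)
    ultimately show ?thesis
      using Cauchy_continuous_map_extends_to_continuous_closure_of
        [of "euclidean_metric :: real metric" "euclidean_metric :: real metric" E "\<lambda>x. f x i"]
      by (metis continuous_map_iff_continuous mtopology_of_euclidean euclidean_closure_of)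
  qed
  then obtain G where contG: "\<And>i. i < n \<Longrightarrow> continuous_on (closure E) (G i)"
    and G: "\<And>i x. i < n \<Longrightarrow> x \<in> E \<Longrightarrow> G i x = f x i"
    by metis
  define g where "g x i = (if i < n then G i x else 0)" for x i
  have gE: "g x = f x" if "x \<in> E" for x
    using G supp that by (auto simp: g_def fun_eq_iff not_less)
  have lim: "(\<lambda>k. f (X k) i) \<longlonglongrightarrow> g x i"
    if "i < n" "\<And>k. X k \<in> E" "x \<in> closure E" "X \<longlonglongrightarrow> x" for i X x
  proof -
    have "(\<lambda>k. G i (X k)) \<longlonglongrightarrow> G i x"
      using that closure_subset [THEN subsetD]
      by (intro continuous_on_tendsto_compose [OF contG]) (auto intro: always_eventually)
    then show ?thesis
      using that by (simp add: G g_def)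
  qed
  have bound: "ndist n (g x) (g a) \<le> \<eta> (\<bar>x - a\<bar> / \<bar>x - b\<bar>) * ndist n (g x) (g b)"
    if cl: "x \<in> closure E" "a \<in> closure E" "b \<in> closure E" and ne: "x \<noteq> b" for x a b
  proof -
    obtain X A B where X: "\<And>k. X k \<in> E" "X \<longlonglongrightarrow> x" and A: "\<And>k. A k \<in> E" "A \<longlonglongrightarrow> a"
      and B: "\<And>k. B k \<in> E" "B \<longlonglongrightarrow> b"
      using cl unfolding closure_sequential by metis
    have q: "(\<lambda>k. \<bar>X k - A k\<bar> / \<bar>X k - B k\<bar>) \<longlonglongrightarrow> \<bar>x - a\<bar> / \<bar>x - b\<bar>"
      using ne by (intro tendsto_intros X A B) auto
    have "(\<lambda>k. \<eta> (\<bar>X k - A k\<bar> / \<bar>X k - B k\<bar>)) \<longlonglongrightarrow> \<eta> (\<bar>x - a\<bar> / \<bar>x - b\<bar>)"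
      using \<eta> by (intro continuous_on_tendsto_compose [OF _ q, of "{0..}"]) (auto simp: modulus_def intro: always_eventually)
    then have rhs: "(\<lambda>k. \<eta> (\<bar>X k - A k\<bar> / \<bar>X k - B k\<bar>) * ndist n (f (X k)) (f (B k)))
        \<longlonglongrightarrow> \<eta> (\<bar>x - a\<bar> / \<bar>x - b\<bar>) * ndist n (g x) (g b)"
      using that X B by (intro tendsto_mult tendsto_ndist lim) auto
    have lhs: "(\<lambda>k. ndist n (f (X k)) (f (A k))) \<longlonglongrightarrow> ndist n (g x) (g a)"
      using that X A by (intro tendsto_ndist lim) auto
    have "(\<lambda>k. X k - B k) \<longlonglongrightarrow> x - b"
      by (intro tendsto_diff X B)
    then have "\<forall>\<^sub>F k in sequentially. X k - B k \<noteq> 0"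
      using ne by (intro tendsto_imp_eventually_ne) auto
    then have "\<forall>\<^sub>F k in sequentially. ndist n (f (X k)) (f (A k)) \<le>
        \<eta> (\<bar>X k - A k\<bar> / \<bar>X k - B k\<bar>) * ndist n (f (X k)) (f (B k))"
      by (rule eventually_mono) (use qs_boundD(2) [OF qs X(1) B(1) _ A(1)] in auto)
    then show ?thesis
      by (intro tendsto_le [OF _ rhs lhs]) auto
  qed
  have pos: "0 < ndist n (g x) (g b)" if "x \<in> closure E" "b \<in> closure E" "x \<noteq> b" for x b
  proof (rule ccontr)
    assume "\<not> 0 < ndist n (g x) (g b)"
    then have zero: "ndist n (g x) (g b) = 0"
      using L2_set_nonneg [of "\<lambda>i. g x i - g b i" "{..<n}"] by linarith
    then have "ndist n (g x) (g a) \<le> 0" if "a \<in> E" for a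
      using bound [of x a b] \<open>x \<in> closure E\<close> \<open>b \<in> closure E\<close> \<open>x \<noteq> b\<close> that closure_subset [THEN subsetD] by auto
    then have "ndist n (g a\<^sub>0) (g x) \<le> 0" "ndist n (g x) (g b\<^sub>0) \<le> 0"
      using two ndist_commute [of "g a\<^sub>0" "g x" n] by auto
    then have "ndist n (f a\<^sub>0) (f b\<^sub>0) \<le> 0"
      using ndist_triangle [of "g a\<^sub>0" "g b\<^sub>0" n "g x"] two by (simp add: gE)
    then show False
      using qs_boundD(1) [OF qs two] by simp
  qed
  show thesis
  proof (rule that)
    show "qs_bound \<eta> n (closure E) g"
      unfolding qs_bound_def using pos bound by blast
  qed (auto simp: gE g_def)
qed

section \<open>Gauges of quasisymmetric maps\<close>

text \<open>
  \<open>\<omega> x r\<close> represents the size of the image of a ball with centre \<open>x\<close> and radius \<open>r\<close>. It grows in \<open>r\<close> at a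
  controlled rate, it is comparable with the actual distances of \<open>f\<close>, and moving the centre within the ball
  changes it by a bounded factor only.
\<close>

locale qs_gauge =
  fixes \<theta> :: "real \<Rightarrow> real" and C :: real and n :: nat and E :: "real set"
    and f :: "real \<Rightarrow> nat \<Rightarrow> real" and \<omega> :: "real \<Rightarrow> real \<Rightarrow> real"
  assumes modulus: "modulus \<theta>"
    and C_ge_1: "1 \<le> C"
    and gauge_pos: "x \<in> E \<Longrightarrow> 0 < r \<Longrightarrow> 0 < \<omega> x r"
    and gauge_scale: "x \<in> E \<Longrightarrow> 0 < s \<Longrightarrow> 0 < t \<Longrightarrow> \<omega> x s \<le> \<theta> (s / t) * \<omega> x t"
    and ndist_le_gauge: "x \<in> E \<Longrightarrow> y \<in> E \<Longrightarrow> x \<noteq> y \<Longrightarrow> ndist n (f x) (f y) \<le> C * \<omega> x \<bar>x - y\<bar>"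
    and gauge_le_ndist: "x \<in> E \<Longrightarrow> y \<in> E \<Longrightarrow> x \<noteq> y \<Longrightarrow> \<omega> x \<bar>x - y\<bar> \<le> C * ndist n (f x) (f y)"
    and gauge_centre: "x \<in> E \<Longrightarrow> y \<in> E \<Longrightarrow> 0 < r \<Longrightarrow> \<bar>x - y\<bar> \<le> r \<Longrightarrow> \<omega> x r \<le> C * \<omega> y r"

text \<open>
  A bound for \<open>\<theta> v * (u / v)\<close> that depends on \<open>u\<close> alone, when \<open>v\<close> lies between \<open>1\<close> and \<open>u\<close> up to the
  factor \<open>C\<close>. Such products arise when a distortion bound is used at a ratio \<open>v\<close> of actual distances and the
  rest of the ratio \<open>u\<close> of radii is bridged linearly.
\<close>

definition warp :: "real \<Rightarrow> (real \<Rightarrow> real) \<Rightarrow> real \<Rightarrow> real" where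
  "warp C \<theta> u = sqrt u * \<theta> C + C * \<theta> (sqrt u) + (C * u) * \<theta> (C * u)"

lemma modulus_warp:
  assumes "modulus \<theta>" "0 \<le> C"
  shows "modulus (warp C \<theta>)"
proof -
  have "modulus (\<lambda>u. \<theta> C * sqrt u)"
    by (rule modulus_cmult [OF modulus_sqrt modulus_nonneg [OF assms]])
  moreover have "modulus (\<lambda>u. C * \<theta> (sqrt u))"
    by (rule modulus_cmult [OF modulus_compose [OF assms(1) modulus_sqrt] assms(2)])
  moreover have "modulus (\<lambda>u. (C * u) * \<theta> (C * u))"
    by (rule modulus_mult [OF modulus_cmult [OF modulus_ident assms(2)] modulus_scale [OF assms]])
  ultimately have "modulus (\<lambda>u. \<theta> C * sqrt u + C * \<theta> (sqrt u) + (C * u) * \<theta> (C * u))"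
    by (intro modulus_add)
  then show ?thesis
    by (simp add: warp_def [abs_def] mult.commute)
qed

lemma warp_bound:
  assumes \<theta>: "modulus \<theta>" and C: "1 \<le> C" and u: "0 < u" and v: "0 < v"
    and small: "u \<le> 1 \<Longrightarrow> u \<le> C * v \<and> v \<le> C"
    and large: "1 \<le> u \<Longrightarrow> 1 \<le> C * v \<and> v \<le> C * u"
  shows "\<theta> v * (u / v) \<le> warp C \<theta> u"
proof -
  have nn: "0 \<le> sqrt u * \<theta> C" "0 \<le> C * \<theta> (sqrt u)" "0 \<le> (C * u) * \<theta> (C * u)" "0 \<le> \<theta> v"
    using modulus_nonneg [OF \<theta>] C u v by auto
  \<comment> \<open>For small u, one of the factors v and u / v of u is at most sqrt u; this is what makes the bound
    tend to zero.\<close>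
  consider "u \<le> 1" "sqrt u \<le> v" | "u \<le> 1" "v \<le> sqrt u" | "1 \<le> u"
    by linarith
  then show ?thesis
  proof cases
    case 1
    have "u = sqrt u * sqrt u"
      using u by simp
    also have "\<dots> \<le> sqrt u * v"
      using 1 u by (intro mult_left_mono) auto
    finally have "u / v \<le> sqrt u"
      using v by (simp add: pos_divide_le_eq)
    moreover have "\<theta> v \<le> \<theta> C"
      using small 1 v by (intro modulus_mono [OF \<theta>]) auto
    ultimately have "\<theta> v * (u / v) \<le> \<theta> C * sqrt u"
      using nn u v modulus_nonneg [OF \<theta>, of C] C by (intro mult_mono) auto
    then show ?thesis
      unfolding warp_def using nn by (simp add: mult.commute)
  next
    case 2
    have "u / v \<le> C"
      using small 2 v by (simp add: pos_divide_le_eq)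
    moreover have "\<theta> v \<le> \<theta> (sqrt u)"
      using 2 v by (intro modulus_mono [OF \<theta>]) auto
    ultimately have "\<theta> v * (u / v) \<le> \<theta> (sqrt u) * C"
      using nn u v modulus_nonneg [OF \<theta>, of "sqrt u"] C by (intro mult_mono) auto
    then show ?thesis
      unfolding warp_def using nn by (simp add: mult.commute)
  next
    case 3
    have "u * 1 \<le> u * (C * v)"
      using large 3 u by (intro mult_left_mono) auto
    then have "u / v \<le> C * u"
      using v by (simp add: pos_divide_le_eq mult_ac)
    moreover have "\<theta> v \<le> \<theta> (C * u)"
      using large 3 v by (intro modulus_mono [OF \<theta>]) auto
    ultimately have "\<theta> v * (u / v) \<le> \<theta> (C * u) * (C * u)"
      using nn u v modulus_nonneg [OF \<theta>, of "C * u"] C by (intro mult_mono) auto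
    then show ?thesis
      unfolding warp_def using nn by (simp add: mult.commute)
  qed
qed

text \<open>
  A point whose distance from \<open>x\<close> represents the radius \<open>r\<close> as well as \<open>E\<close> permits: a point in the shell if
  there is one, otherwise a nearly nearest point or a nearly farthest point, according to the side
  on which \<open>E\<close> lies.
\<close>

definition reference :: "real \<Rightarrow> real set \<Rightarrow> real \<Rightarrow> real \<Rightarrow> real \<Rightarrow> bool" where
  "reference M E x r y \<longleftrightarrow> y \<in> E \<and> y \<noteq> x \<and>
     (r \<le> M * \<bar>x - y\<bar> \<and> \<bar>x - y\<bar> \<le> r \<or>
      (\<forall>z\<in>E. z \<noteq> x \<longrightarrow> r < \<bar>x - z\<bar> \<and> \<bar>x - y\<bar> \<le> 2 * \<bar>x - z\<bar>) \<or>
      (\<forall>z\<in>E. \<bar>x - z\<bar> \<le> r \<and> \<bar>x - z\<bar> \<le> 2 * \<bar>x - y\<bar>))"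

lemma reference_cases:
  assumes "reference M E x r y"
  obtains (shell) "r \<le> M * \<bar>x - y\<bar>" "\<bar>x - y\<bar> \<le> r"
    | (beyond) "\<And>z. z \<in> E \<Longrightarrow> z \<noteq> x \<Longrightarrow> r < \<bar>x - z\<bar>" "\<And>z. z \<in> E \<Longrightarrow> z \<noteq> x \<Longrightarrow> \<bar>x - y\<bar> \<le> 2 * \<bar>x - z\<bar>"
    | (within) "\<And>z. z \<in> E \<Longrightarrow> \<bar>x - z\<bar> \<le> r" "\<And>z. z \<in> E \<Longrightarrow> \<bar>x - z\<bar> \<le> 2 * \<bar>x - y\<bar>"
  using assms unfolding reference_def by metis

lemma referenceD: "reference M E x r y \<Longrightarrow> y \<in> E" "reference M E x r y \<Longrightarrow> y \<noteq> x"
  by (auto simp: reference_def)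

lemma reference_exists:
  assumes ann: "annular M E" and M: "1 \<le> M" and x: "x \<in> E" and w: "w \<in> E" "w \<noteq> x" and r: "0 < r"
  shows "\<exists>y. reference M E x r y"
  using ann x r
proof (cases rule: annular_cases)
  case (shell y)
  then have "r \<le> M * \<bar>x - y\<bar>"
    using M by (simp add: pos_divide_le_eq mult.commute)
  with shell r show ?thesis
    unfolding reference_def by force
next
  case beyond
  let ?D = "(\<lambda>z. \<bar>x - z\<bar>) ` (E - {x})"
  have ne: "?D \<noteq> {}" and bdd: "bdd_below ?D"
    using w by (auto intro!: bdd_belowI [of _ 0])
  have "r \<le> Inf ?D"
    using beyond by (intro cInf_greatest [OF ne]) (auto intro: less_imp_le)
  then have "Inf ?D < 2 * Inf ?D"
    using r by simp
  then obtain y where y: "y \<in> E" "y \<noteq> x" "\<bar>x - y\<bar> < 2 * Inf ?D"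
    using cInf_lessD [OF ne] by blast
  have "\<bar>x - y\<bar> \<le> 2 * \<bar>x - z\<bar>" if "z \<in> E" "z \<noteq> x" for z
  proof -
    have "Inf ?D \<le> \<bar>x - z\<bar>"
      using that by (intro cInf_lower [OF _ bdd]) auto
    with y(3) show ?thesis by argo
  qed
  with y beyond show ?thesis
    unfolding reference_def by blast
next
  case within
  let ?D = "(\<lambda>z. \<bar>x - z\<bar>) ` E"
  have ne: "?D \<noteq> {}" and bdd: "bdd_above ?D"
    using w within by (auto intro!: bdd_aboveI [of _ r])
  have "\<bar>x - w\<bar> \<le> Sup ?D"
    using w by (intro cSup_upper [OF _ bdd]) auto
  then have pos: "0 < Sup ?D"
    using w by auto
  then have "Sup ?D / 2 < Sup ?D"
    by simp
  then obtain y where y: "y \<in> E" "Sup ?D / 2 < \<bar>x - y\<bar>"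
    using less_cSupD [OF ne] by blast
  have "\<bar>x - z\<bar> \<le> 2 * \<bar>x - y\<bar>" if "z \<in> E" for z
  proof -
    have "\<bar>x - z\<bar> \<le> Sup ?D"
      using that by (intro cSup_upper [OF _ bdd]) auto
    with y(2) show ?thesis by argo
  qed
  moreover have "y \<noteq> x"
    using y(2) pos by auto
  ultimately show ?thesis
    using y(1) within unfolding reference_def by blast
qed

text \<open>
  The distance of the reference point behaves like a monotone and non-expanding function of the radius
  on the logarithmic scale, up to constants. This is checked for every combination of the three kinds of
  reference points.
\<close>

lemma reference_ratio:
  assumes M: "1 \<le> M" and s: "0 < s" and st: "s \<le> t"
    and y: "reference M E x s y" and z: "reference M E x t z"
  shows "\<bar>x - y\<bar> \<le> 2 * M * \<bar>x - z\<bar>" and "s * \<bar>x - z\<bar> \<le> 2 * M * (t * \<bar>x - y\<bar>)"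
proof -
  let ?A = "\<bar>x - y\<bar>" and ?B = "\<bar>x - z\<bar>"
  note yz = referenceD [OF y] referenceD [OF z]
  have scale: "c * B \<le> c * M * B" "M * B \<le> 2 * M * B" if "0 \<le> B" "0 \<le> c" for c B
    using M that by (auto intro!: mult_right_mono simp: mult_le_cancel_left1)
  have "?A \<le> 2 * ?B \<or> ?A \<le> M * ?B"
    using y by (cases rule: reference_cases; use z in \<open>cases rule: reference_cases\<close>) (use yz st in force)+
  then show "?A \<le> 2 * M * ?B"
    using scale [of ?B 2] by auto
  have "s \<le> M * ?A \<and> ?B \<le> t \<or> ?B \<le> 2 * ?A"
  proof -
    have "?A \<le> M * ?A"
      using scale(1) [of ?A 1] by simp
    have y_beyond: ?thesis if "s \<le> M * ?A" "t < ?A \<Longrightarrow> ?B \<le> 2 * ?A"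
      using z
    proof (cases rule: reference_cases)
      case beyond
      with that(2) beyond(1) [OF yz(1,2)] show ?thesis by blast
    next
      case within
      with that(1) within(1) [OF yz(3)] show ?thesis by blast
    qed (use that in blast)
    show ?thesis
      using y
    proof (cases rule: reference_cases)
      case shell
      with st y_beyond show ?thesis by linarith
    next
      case beyond
      have "s < ?A" by (rule beyond(1) [OF yz(1,2)])
      moreover have "?B \<le> 2 * ?A" if "t < ?A"
        using z
      proof (cases rule: reference_cases)
        case zbeyond: beyond
        show ?thesis by (rule zbeyond(2) [OF yz(1,2)])
      next
        case shell
        with that(1) show ?thesis by argo
      next
        case within
        with that(1) within(1) [OF yz(3)] show ?thesis by argo
      qed
      ultimately show ?thesis
        using y_beyond \<open>?A \<le> M * ?A\<close> by linarith
    next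
      case within
      with yz(3) show ?thesis by blast
    qed
  qed
  then show "s * ?B \<le> 2 * M * (t * ?A)"
  proof
    assume "s \<le> M * ?A \<and> ?B \<le> t"
    then have "s * ?B \<le> (M * ?A) * t"
      using s M by (intro mult_mono) auto
    also have "\<dots> \<le> 2 * ((M * ?A) * t)"
      using s st M by simp
    finally show ?thesis by (simp add: mult_ac)
  next
    assume "?B \<le> 2 * ?A"
    then have "s * ?B \<le> t * (2 * ?A)"
      using s st by (intro mult_mono) auto
    also have "\<dots> \<le> M * (t * (2 * ?A))"
      using scale(1) [of "t * (2 * ?A)" 1] s st by simp
    finally show ?thesis by (simp add: mult_ac)
  qed
qed

text \<open>
  The gauge at \<open>(x, r)\<close> is the distance between the images of \<open>x\<close> and a reference point \<open>q x r\<close>, times the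
  correction \<open>r / \<bar>x - q x r\<bar>\<close>. In the shell case the correction is bounded; in the two other cases the
  reference distance is essentially constant and the correction continues the gauge linearly.
\<close>

lemma qs_gauge_if_qs_bound:
  assumes \<eta>: "modulus \<eta>" and qs: "qs_bound \<eta> n E f"
    and ann: "annular M E" and M: "1 \<le> M" and two: "a\<^sub>0 \<in> E" "b\<^sub>0 \<in> E" "a\<^sub>0 \<noteq> b\<^sub>0"
  shows "\<exists>\<omega>. qs_gauge (warp (2 * M) \<eta>) (1 + 2 * M * \<eta> (2 * M) + 4 * M * (\<eta> (4 * M) + \<eta> (8 * M))) n E f \<omega>"
proof -
  have "\<exists>y. reference M E x r y" if "x \<in> E" "0 < r" for x r
  proof (cases "x = a\<^sub>0")
    case True
    then show ?thesis
      using reference_exists [OF ann M that(1) two(2) _ that(2)] two(3) by simp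
  next
    case False
    then show ?thesis
      using reference_exists [OF ann M that(1) two(1) _ that(2)] by simp
  qed
  then obtain q where q: "\<And>x r. x \<in> E \<Longrightarrow> 0 < r \<Longrightarrow> reference M E x r (q x r)"
    by metis
  define \<omega> where "\<omega> x r = ndist n (f x) (f (q x r)) * (r / \<bar>x - q x r\<bar>)" for x r
  have nn: "0 \<le> \<eta> t" if "0 \<le> t" for t
    using modulus_nonneg [OF \<eta>] that .
  have qE: "q x r \<in> E" "x \<noteq> q x r" "0 < \<bar>x - q x r\<bar>" if "x \<in> E" "0 < r" for x r
    using referenceD [OF q [OF that]] by auto
  define C where "C = 1 + 2 * M * \<eta> (2 * M) + 4 * M * (\<eta> (4 * M) + \<eta> (8 * M))"
  have nnC: "0 \<le> \<eta> (2 * M)" "0 \<le> \<eta> (4 * M) + \<eta> (8 * M)"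
    using M by (auto intro!: nn add_nonneg_nonneg)
  have C1: "1 \<le> C" and C2: "2 * M * \<eta> (2 * M) \<le> C" and C3: "4 * M * (\<eta> (4 * M) + \<eta> (8 * M)) \<le> C"
    and C4: "\<eta> (2 * M) \<le> C"
  proof -
    have "0 \<le> 2 * M * \<eta> (2 * M)" "0 \<le> 4 * M * (\<eta> (4 * M) + \<eta> (8 * M))"
      using nnC M by auto
    moreover have "\<eta> (2 * M) \<le> 2 * M * \<eta> (2 * M)"
      using nnC M by (simp add: mult_le_cancel_right1)
    ultimately show "1 \<le> C" "2 * M * \<eta> (2 * M) \<le> C" "4 * M * (\<eta> (4 * M) + \<eta> (8 * M)) \<le> C" "\<eta> (2 * M) \<le> C"
      unfolding C_def by linarith+
  qed
  have "qs_gauge (warp (2 * M) \<eta>) C n E f \<omega>"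
  proof
    show "modulus (warp (2 * M) \<eta>)"
      using M by (intro modulus_warp [OF \<eta>]) simp
    show "1 \<le> C" by (rule C1)
  next
    fix x r :: real assume "x \<in> E" "0 < r"
    then show "0 < \<omega> x r"
      using qE [of x r] qs_boundD(1) [OF qs, of x "q x r"] by (simp add: \<omega>_def)
  next
    fix x s t :: real assume x: "x \<in> E" and s: "0 < s" and t: "0 < t"
    let ?A = "\<bar>x - q x s\<bar>" and ?B = "\<bar>x - q x t\<bar>" and ?N = "ndist n (f x) (f (q x t))"
    have A: "0 < ?A" and B: "0 < ?B"
      using qE x s t by auto
    have "\<eta> (?A / ?B) * ((s / t) / (?A / ?B)) \<le> warp (2 * M) \<eta> (s / t)"
    proof (rule warp_bound [OF \<eta>])
      assume "s / t \<le> 1"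
      then have "s \<le> t" using t by simp
      from reference_ratio [OF M s this q [OF x s] q [OF x t]]
      show "s / t \<le> 2 * M * (?A / ?B) \<and> ?A / ?B \<le> 2 * M"
        using B t by (simp add: field_simps)
    next
      assume "1 \<le> s / t"
      then have "t \<le> s" using t by simp
      from reference_ratio [OF M t this q [OF x t] q [OF x s]]
      show "1 \<le> 2 * M * (?A / ?B) \<and> ?A / ?B \<le> 2 * M * (s / t)"
        using B t by (simp add: field_simps)
    qed (use M s t A B in auto)
    then have *: "\<eta> (?A / ?B) * ((s / t) / (?A / ?B)) * (?N * (t / ?B)) \<le> warp (2 * M) \<eta> (s / t) * (?N * (t / ?B))"
      using t by (intro mult_right_mono) auto
    have "\<omega> x s \<le> (\<eta> (?A / ?B) * ?N) * (s / ?A)"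
      unfolding \<omega>_def using s qs_boundD(2) [OF qs x qE(1,2) [OF x t] qE(1) [OF x s]]
      by (intro mult_right_mono) auto
    also have "\<dots> = \<eta> (?A / ?B) * ((s / t) / (?A / ?B)) * (?N * (t / ?B))"
      using A B t by (simp add: field_simps)
    finally show "\<omega> x s \<le> warp (2 * M) \<eta> (s / t) * \<omega> x t"
      using * unfolding \<omega>_def by linarith
  next
    fix x y assume x: "x \<in> E" and y: "y \<in> E" and ne: "x \<noteq> y"
    define r where "r = \<bar>x - y\<bar>"
    define p where "p = q x r"
    let ?A = "\<bar>x - p\<bar>" and ?N = "ndist n (f x) (f p)"
    have r: "0 < r" using ne by (simp add: r_def)
    have p: "p \<in> E" "x \<noteq> p" "0 < ?A" "reference M E x r p"
      using qE [OF x r] q [OF x r] by (simp_all add: p_def)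
    have "?A \<le> M * ?A"
      using mult_right_mono [OF M, of ?A] by simp
    with p(4) have A: "?A \<le> r \<and> r \<le> 2 * M * ?A"
    proof (cases rule: reference_cases)
      case beyond
      then show ?thesis
        using beyond(1) [OF y] ne by (simp add: r_def)
    next
      case within
      then show ?thesis
        using within(1) [OF p(1)] within(2) [OF y] \<open>?A \<le> M * ?A\<close> by (simp add: r_def)
    qed auto
    have \<omega>: "\<omega> x \<bar>x - y\<bar> = ?N * (r / ?A)"
      by (simp add: \<omega>_def r_def p_def)
    have q1: "1 \<le> r / ?A" and q2: "r / ?A \<le> 2 * M"
      using A p(3) by (auto simp: pos_le_divide_eq pos_divide_le_eq)
    have "ndist n (f x) (f y) \<le> \<eta> (r / ?A) * ?N"
      using qs_boundD(2) [OF qs x p(1,2) y] by (simp add: r_def)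
    also have "\<dots> \<le> C * (?N * (r / ?A))"
    proof (rule order_trans)
      show "\<eta> (r / ?A) * ?N \<le> C * ?N"
        using modulus_mono [OF \<eta> order_trans [OF zero_le_one q1] q2] C4 by (intro mult_right_mono) auto
      have "?N * 1 \<le> ?N * (r / ?A)"
        using q1 by (intro mult_left_mono) auto
      then show "C * ?N \<le> C * (?N * (r / ?A))"
        using C1 by (intro mult_left_mono) auto
    qed
    finally show "ndist n (f x) (f y) \<le> C * \<omega> x \<bar>x - y\<bar>"
      by (simp only: \<omega>)
    have "?N \<le> \<eta> (?A / r) * ndist n (f x) (f y)"
      using qs_boundD(2) [OF qs x y ne p(1)] by (simp add: r_def)
    also have "\<dots> \<le> \<eta> (2 * M) * ndist n (f x) (f y)"
    proof -
      have "?A / r \<le> 1"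
        using A r by simp
      then have "?A / r \<le> 2 * M"
        using M by linarith
      then show ?thesis
        using r by (intro mult_right_mono modulus_mono [OF \<eta>]) auto
    qed
    finally have "?N * (r / ?A) \<le> (\<eta> (2 * M) * ndist n (f x) (f y)) * (2 * M)"
      using q1 q2 nnC by (intro mult_mono) auto
    also have "\<dots> = (2 * M * \<eta> (2 * M)) * ndist n (f x) (f y)"
      by simp
    also have "\<dots> \<le> C * ndist n (f x) (f y)"
      using C2 by (intro mult_right_mono) auto
    finally show "\<omega> x \<bar>x - y\<bar> \<le> C * ndist n (f x) (f y)"
      by (simp only: \<omega>)
  next
    fix x y r assume x: "x \<in> E" and y: "y \<in> E" and r: "0 < r" and le: "\<bar>x - y\<bar> \<le> r"
    show "\<omega> x r \<le> C * \<omega> y r"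
    proof (cases "x = y")
      case True
      moreover have "0 \<le> \<omega> y r"
        using r by (simp add: \<omega>_def)
      ultimately show ?thesis
        using C1 by (simp add: mult_le_cancel_right1)
    next
      case ne: False
      \<comment> \<open>If both centres lie in the ball, their reference points lie at comparable distances, and these are
        at least comparable with the distance of the centres.\<close>
      have near: "\<bar>x - q x r\<bar> \<le> 4 * M * \<bar>y - q y r\<bar> \<and> \<bar>x - y\<bar> \<le> 4 * M * \<bar>y - q y r\<bar>"
        if x: "x \<in> E" and y: "y \<in> E" and le: "\<bar>x - y\<bar> \<le> r" and ne: "x \<noteq> y" for x y
      proof -
        let ?B = "\<bar>y - q y r\<bar>"
        have B: "4 * ?B \<le> 4 * M * ?B" "M * ?B \<le> 4 * M * ?B"
          using M mult_right_mono [OF M, of ?B] by auto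
        have p: "\<bar>x - q x r\<bar> \<le> r"
          using q [OF x r]
        proof (cases rule: reference_cases)
          case beyond
          then show ?thesis
            using beyond(1) [OF y] ne le by simp
        qed (use qE [OF x r] in auto)
        show ?thesis
          using q [OF y r]
        proof (cases rule: reference_cases)
          case shell
          then show ?thesis
            using p le B by linarith
        next
          case beyond
          then show ?thesis
            using beyond(1) [OF x] ne le by simp
        next
          case within
          have "\<bar>y - x\<bar> \<le> 2 * ?B" "\<bar>y - q x r\<bar> \<le> 2 * ?B"
            using within(2) x qE [OF x r] by auto
          then show ?thesis
            using B by argo
        qed
      qed
      define p where "p = q x r"
      define z where "z = q y r"
      let ?A = "\<bar>x - p\<bar>" and ?B = "\<bar>y - z\<bar>" and ?N = "ndist n (f y) (f z)"
      have p: "p \<in> E" "0 < ?A" and z: "z \<in> E" "y \<noteq> z" "0 < ?B"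
        using qE [OF x r] qE [OF y r] by (simp_all add: p_def z_def)
      have AB: "?A \<le> 4 * M * ?B" "\<bar>x - y\<bar> \<le> 4 * M * ?B" "?B \<le> 4 * M * ?A"
        using near [OF x y le ne] near [OF y x] le ne by (auto simp: p_def z_def abs_minus_commute)
      have "ndist n (f y) (f x) \<le> \<eta> (\<bar>y - x\<bar> / ?B) * ?N"
        by (rule qs_boundD(2) [OF qs y z(1,2) x])
      also have "\<dots> \<le> \<eta> (4 * M) * ?N"
        using AB z(3) by (intro mult_right_mono modulus_mono [OF \<eta>]) (auto simp: pos_divide_le_eq abs_minus_commute)
      finally have N1: "ndist n (f y) (f x) \<le> \<eta> (4 * M) * ?N" .
      have "ndist n (f y) (f p) \<le> \<eta> (\<bar>y - p\<bar> / ?B) * ?N"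
        by (rule qs_boundD(2) [OF qs y z(1,2) p(1)])
      also have "\<dots> \<le> \<eta> (8 * M) * ?N"
      proof -
        have "\<bar>y - p\<bar> \<le> 8 * M * ?B"
          using AB(1,2) by argo
        then show ?thesis
          using z(3) by (intro mult_right_mono modulus_mono [OF \<eta>]) (auto simp: pos_divide_le_eq)
      qed
      finally have N2: "ndist n (f y) (f p) \<le> \<eta> (8 * M) * ?N" .
      have "ndist n (f x) (f p) \<le> ndist n (f y) (f x) + ndist n (f y) (f p)"
        using ndist_triangle [of "f x" "f p" n "f y"] ndist_commute [of "f x" "f y" n] by simp
      with N1 N2 have N: "ndist n (f x) (f p) \<le> (\<eta> (4 * M) + \<eta> (8 * M)) * ?N"
        by (simp add: distrib_right)
      have "r / ?A \<le> 4 * M * (r / ?B)"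
      proof -
        have "r * ?B \<le> r * (4 * M * ?A)"
          using AB(3) r by (intro mult_left_mono) auto
        then show ?thesis
          using p(2) z(3) by (simp add: field_simps)
      qed
      with N have "ndist n (f x) (f p) * (r / ?A) \<le> ((\<eta> (4 * M) + \<eta> (8 * M)) * ?N) * (4 * M * (r / ?B))"
        using r nnC by (intro mult_mono) auto
      also have "\<dots> = (4 * M * (\<eta> (4 * M) + \<eta> (8 * M))) * (?N * (r / ?B))"
        by simp
      also have "\<dots> \<le> C * (?N * (r / ?B))"
        using C3 r by (intro mult_right_mono) auto
      finally show ?thesis
        by (simp add: \<omega>_def p_def z_def)
    qed
  qed
  then show ?thesis
    unfolding C_def by blast
qed

section \<open>Interpolation across the gaps of a closed set\<close>

text \<open>
  The ends of the component of the complement of \<open>E\<close> that contains \<open>x\<close>. On an unbounded component both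
  functions take the value of its only end, and for \<open>x \<in> E\<close> both are \<open>x\<close>.
\<close>

definition gap_left :: "real set \<Rightarrow> real \<Rightarrow> real" where
  "gap_left E x = (if {e \<in> E. e \<le> x} = {} then Inf E else Sup {e \<in> E. e \<le> x})"

definition gap_right :: "real set \<Rightarrow> real \<Rightarrow> real" where
  "gap_right E x = (if {e \<in> E. x \<le> e} = {} then Sup E else Inf {e \<in> E. x \<le> e})"

text \<open>
  The weight is \<open>0\<close> on the left third and \<open>1\<close> on the right third of a gap. If both ends coincide, division
  by zero makes the quotient \<open>0\<close> and hence the weight \<open>0\<close>.
\<close>

definition gap_weight :: "real set \<Rightarrow> real \<Rightarrow> real" where
  "gap_weight E x = max 0 (min 1 (3 * (x - gap_left E x) / (gap_right E x - gap_left E x) - 1))"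

lemma gap_weight_range: "0 \<le> gap_weight E x" "gap_weight E x \<le> 1"
  by (auto simp: gap_weight_def)

lemma infdist_attained_real:
  assumes "closed E" "E \<noteq> {}"
  obtains e where "e \<in> E" "infdist x E = \<bar>x - e\<bar>"
  using infdist_attains_inf [OF assms, of x] by (metis dist_real_def)

lemma infdist_le_abs: "e \<in> E \<Longrightarrow> infdist x E \<le> \<bar>x - e\<bar>"
  using infdist_le [of e E x] by (simp add: dist_real_def)

lemma infdist_lipschitz: "\<bar>infdist x E - infdist y E\<bar> \<le> \<bar>x - y\<bar>"
  using infdist_triangle [of x E y] infdist_triangle [of y E x]
  by (auto simp: dist_real_def abs_minus_commute)

lemma gap_cases:
  assumes "closed E" "E \<noteq> {}"
  obtains
    (between) "gap_left E x \<in> E" "gap_right E x \<in> E" "gap_left E x \<le> x" "x \<le> gap_right E x"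
      "\<And>e. e \<in> E \<Longrightarrow> e \<le> gap_left E x \<or> gap_right E x \<le> e"
  | (outside) "gap_left E x \<in> E" "gap_right E x = gap_left E x"
      "\<And>e. e \<in> E \<Longrightarrow> \<bar>x - gap_left E x\<bar> \<le> \<bar>x - e\<bar>"
proof -
  let ?L = "{e \<in> E. e \<le> x}" and ?R = "{e \<in> E. x \<le> e}"
  have clL: "closed ?L" and clR: "closed ?R"
    using closed_Int [OF assms(1) closed_atMost [of x]] closed_Int [OF assms(1) closed_atLeast [of x]]
    by (simp_all add: Int_def)
  have bddL: "bdd_above ?L" and bddR: "bdd_below ?R"
    by (auto intro!: bdd_aboveI [of _ x] bdd_belowI [of _ x])
  have ne: "?L \<noteq> {} \<or> ?R \<noteq> {}"
    using assms(2) linear by fastforce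
  consider "?L \<noteq> {}" "?R \<noteq> {}" | "?L = {}" | "?R = {}"
    by blast
  then show thesis
  proof cases
    case 1
    have L: "gap_left E x \<in> ?L"
      using closed_contains_Sup [OF 1(1) bddL clL] 1 by (auto simp: gap_left_def)
    have R: "gap_right E x \<in> ?R"
      using closed_contains_Inf [OF 1(2) bddR clR] 1 by (auto simp: gap_right_def)
    have "e \<le> gap_left E x \<or> gap_right E x \<le> e" if "e \<in> E" for e
    proof (cases "e \<le> x")
      case True
      then have "e \<le> Sup ?L"
        using that by (intro cSup_upper [OF _ bddL]) auto
      then show ?thesis
        using 1 by (auto simp: gap_left_def)
    next
      case False
      then have "Inf ?R \<le> e"
        using that by (intro cInf_lower [OF _ bddR]) auto
      then show ?thesis
        using 1 by (auto simp: gap_right_def)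
    qed
    then show thesis
      using L R by (intro between) auto
  next
    case 2
    then have gt: "x < e" if "e \<in> E" for e
      using that by auto
    then have "?R = E"
      by (auto intro: less_imp_le)
    with 2 have eq: "gap_left E x = Inf E" "gap_right E x = Inf E"
      using ne by (auto simp: gap_left_def gap_right_def)
    have bdd: "bdd_below E"
      using gt by (intro bdd_belowI [of _ x]) (auto intro: less_imp_le)
    have "Inf E \<in> E"
      using closed_contains_Inf [OF assms(2) bdd assms(1)] .
    moreover have "Inf E \<le> e" if "e \<in> E" for e
      using that by (intro cInf_lower [OF _ bdd])
    ultimately show thesis
      using eq gt by (intro outside) force+
  next
    case 3
    then have lt: "e < x" if "e \<in> E" for e
      using that by auto
    then have "?L = E"
      by (auto intro: less_imp_le)
    with 3 have eq: "gap_left E x = Sup E" "gap_right E x = Sup E"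
      using ne by (auto simp: gap_left_def gap_right_def)
    have bdd: "bdd_above E"
      using lt by (intro bdd_aboveI [of _ x]) (auto intro: less_imp_le)
    have "Sup E \<in> E"
      using closed_contains_Sup [OF assms(2) bdd assms(1)] .
    moreover have "e \<le> Sup E" if "e \<in> E" for e
      using that by (intro cSup_upper [OF _ bdd])
    ultimately show thesis
      using eq lt by (intro outside) force+
  qed
qed

lemma gap_ends_mem:
  assumes "closed E" "E \<noteq> {}"
  shows "gap_left E x \<in> E" "gap_right E x \<in> E"
  by (rule gap_cases [OF assms, of x]; simp)+

text \<open>
  An end of the gap that enters the interpolation at \<open>x\<close> with positive weight is at distance at most twice
  \<open>infdist x E\<close>, because \<open>x\<close> is not in the third next to the opposite end.
\<close>

lemma gap_left_close:
  assumes E: "closed E" "E \<noteq> {}" and w: "gap_weight E x < 1"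
  shows "\<bar>x - gap_left E x\<bar> \<le> 2 * infdist x E"
proof -
  let ?l = "gap_left E x" and ?u = "gap_right E x"
  obtain e where e: "e \<in> E" "infdist x E = \<bar>x - e\<bar>"
    using infdist_attained_real [OF E] .
  show ?thesis
    using E
  proof (cases rule: gap_cases [where x = x])
    case between
    show ?thesis
    proof (cases "?l = ?u")
      case True
      then show ?thesis
        using between by (simp add: infdist_nonneg)
    next
      case False
      then have lu: "0 < ?u - ?l"
        using between by simp
      have "3 * (x - ?l) / (?u - ?l) < 2"
        using w by (auto simp: gap_weight_def)
      then have "3 * (x - ?l) < 2 * (?u - ?l)"
        using lu by (simp add: pos_divide_less_eq)
      then show ?thesis
        using between(3,4) between(5) [OF e(1)] e(2) by argo
    qed
  next
    case outside
    then show ?thesis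
      using outside(3) [OF e(1)] e(2) by argo
  qed
qed

lemma gap_right_close:
  assumes E: "closed E" "E \<noteq> {}" and w: "0 < gap_weight E x"
  shows "\<bar>x - gap_right E x\<bar> \<le> 2 * infdist x E"
proof -
  let ?l = "gap_left E x" and ?u = "gap_right E x"
  obtain e where e: "e \<in> E" "infdist x E = \<bar>x - e\<bar>"
    using infdist_attained_real [OF E] .
  show ?thesis
    using E
  proof (cases rule: gap_cases [where x = x])
    case between
    show ?thesis
    proof (cases "?l = ?u")
      case True
      then show ?thesis
        using between by (simp add: infdist_nonneg)
    next
      case False
      then have lu: "0 < ?u - ?l"
        using between by simp
      have "1 < 3 * (x - ?l) / (?u - ?l)"
        using w by (auto simp: gap_weight_def)
      then have "?u - ?l < 3 * (x - ?l)"
        using lu by (simp add: pos_less_divide_eq)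
      then show ?thesis
        using between(3,4) between(5) [OF e(1)] e(2) by argo
    qed
  next
    case outside
    then show ?thesis
      using outside(3) [OF e(1)] e(2) by argo
  qed
qed

lemma same_gap:
  assumes E: "closed E" "E \<noteq> {}" and xy: "\<bar>x - y\<bar> < infdist x E"
  shows "gap_left E y = gap_left E x" "gap_right E y = gap_right E x"
    and "\<bar>gap_weight E x - gap_weight E y\<bar> * infdist x E \<le> 2 * \<bar>x - y\<bar>"
proof -
  have "e \<le> x \<longleftrightarrow> e \<le> y" "x \<le> e \<longleftrightarrow> y \<le> e" if "e \<in> E" for e
    using infdist_le_abs [OF that, of x] xy by argo+
  then have sides: "{e \<in> E. e \<le> y} = {e \<in> E. e \<le> x}" "{e \<in> E. y \<le> e} = {e \<in> E. x \<le> e}"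
    by auto
  show l: "gap_left E y = gap_left E x" and u: "gap_right E y = gap_right E x"
    by (simp_all only: gap_left_def gap_right_def sides)
  let ?l = "gap_left E x" and ?u = "gap_right E x"
  show "\<bar>gap_weight E x - gap_weight E y\<bar> * infdist x E \<le> 2 * \<bar>x - y\<bar>"
    using E
  proof (cases rule: gap_cases [where x = x])
    case between
    then have D: "2 * infdist x E \<le> ?u - ?l" and pos: "0 < ?u - ?l"
      using infdist_le_abs [of ?l E x] infdist_le_abs [of ?u E x] xy by argo+
    have "\<bar>gap_weight E x - gap_weight E y\<bar> \<le> \<bar>3 * (x - ?l) / (?u - ?l) - 3 * (y - ?l) / (?u - ?l)\<bar>"
      unfolding gap_weight_def l u by argo
    also have "\<dots> = \<bar>3 * (x - y) / (?u - ?l)\<bar>"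
      by (simp add: diff_divide_distrib [symmetric] algebra_simps)
    also have "\<dots> = 3 * \<bar>x - y\<bar> / (?u - ?l)"
      using pos by (simp add: abs_mult del: right_diff_distrib_numeral)
    finally have "\<bar>gap_weight E x - gap_weight E y\<bar> * infdist x E
        \<le> 3 * \<bar>x - y\<bar> / (?u - ?l) * ((?u - ?l) / 2)"
      using D pos by (intro mult_mono) (auto simp: infdist_nonneg)
    also have "\<dots> \<le> 2 * \<bar>x - y\<bar>"
      using pos by simp
    finally show ?thesis .
  next
    case outside
    then show ?thesis
      by (simp add: gap_weight_def l u)
  qed
qed

definition blend :: "real \<Rightarrow> real \<Rightarrow> real \<Rightarrow> real" where
  "blend w a b = (1 - w) * a + w * b"

lemma blend_le:
  assumes "0 \<le> w" "w \<le> 1" "w < 1 \<Longrightarrow> a \<le> c" "0 < w \<Longrightarrow> b \<le> c"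
  shows "blend w a b \<le> c"
proof -
  have "(1 - w) * a \<le> (1 - w) * c" "w * b \<le> w * c"
    using assms by (cases "w = 1"; cases "w = 0"; simp add: mult_left_mono)+
  then show ?thesis
    by (simp add: blend_def algebra_simps)
qed

lemma le_blend:
  assumes "0 \<le> w" "w \<le> 1" "w < 1 \<Longrightarrow> c \<le> a" "0 < w \<Longrightarrow> c \<le> b"
  shows "c \<le> blend w a b"
  using blend_le [of w "- a" "- c" "- b"] assms by (simp add: blend_def)

lemma ndist_blend_le:
  assumes "0 \<le> w" "w \<le> 1" "w < 1 \<Longrightarrow> ndist n a q \<le> c" "0 < w \<Longrightarrow> ndist n b q \<le> c"
  shows "ndist n (\<lambda>i. blend w (a i) (b i)) q \<le> c"
proof -
  have eq: "(\<lambda>i. blend w (a i) (b i) - q i) = (\<lambda>i. (1 - w) * (a i - q i) + w * (b i - q i))"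
    by (auto simp: blend_def algebra_simps)
  have "ndist n (\<lambda>i. blend w (a i) (b i)) q \<le> blend w (ndist n a q) (ndist n b q)"
    using L2_set_triangle_ineq [of "\<lambda>i. (1 - w) * (a i - q i)" "\<lambda>i. w * (b i - q i)" "{..<n}"] assms(1,2)
    unfolding eq by (simp add: blend_def L2_set_right_distrib)
  also have "\<dots> \<le> c"
    by (rule blend_le [OF assms])
  finally show ?thesis .
qed

lemma ndist_blend_blend:
  "ndist n (\<lambda>i. blend w (a i) (b i)) (\<lambda>i. blend w' (a i) (b i)) = \<bar>w - w'\<bar> * ndist n a b"
proof -
  have "(blend w (a i) (b i) - blend w' (a i) (b i))\<^sup>2 = (\<bar>w - w'\<bar> * (a i - b i))\<^sup>2" for i
    by (simp add: blend_def power2_eq_square abs_mult_self algebra_simps)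
  then have "ndist n (\<lambda>i. blend w (a i) (b i)) (\<lambda>i. blend w' (a i) (b i))
      = L2_set (\<lambda>i. \<bar>w - w'\<bar> * (a i - b i)) {..<n}"
    by (simp add: L2_set_def)
  then show ?thesis
    by (simp add: L2_set_right_distrib)
qed

lemma abs_blend_diff: "\<bar>blend w a b - blend w' a b\<bar> = \<bar>w - w'\<bar> * \<bar>a - b\<bar>"
proof -
  have "blend w a b - blend w' a b = - ((w - w') * (a - b))"
    by (simp add: blend_def algebra_simps)
  then show ?thesis
    by (simp add: abs_mult)
qed

section \<open>Bumps, phases and the assembly of coordinates\<close>

text \<open>
  The support \<open>[1/2, 2]\<close> makes at most two consecutive dyadic scales active at a given distance. The value
  is at least \<open>1 / 2\<close> on \<open>[3/4, 3/2]\<close>, an interval of ratio \<open>2\<close>, so every positive distance has a dyadic scale at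
  which it is well inside the support.
\<close>

definition bump :: "real \<Rightarrow> real" where
  "bump t = max 0 (min (2 * t - 1) (2 - t))"

lemma bump_range: "0 \<le> bump t" "bump t \<le> 1"
  by (auto simp: bump_def)

lemma bump_support: "bump t \<noteq> 0 \<Longrightarrow> 1 / 2 < t \<and> t < 2"
  unfolding bump_def by argo

lemma bump_lipschitz: "\<bar>bump s - bump t\<bar> \<le> 2 * \<bar>s - t\<bar>"
  unfolding bump_def by argo

lemma bump_scale_exists:
  assumes "0 < d"
  obtains k where "1 / 2 \<le> bump (d / 2 powi k)"
proof -
  define k where "k = \<lfloor>log 2 d\<rfloor>"
  have "2 powr of_int k \<le> 2 powr log 2 d" "2 powr log 2 d < 2 powr (of_int k + 1)"
    unfolding k_def by (intro powr_mono powr_less_mono; linarith)+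
  then have k: "2 powi k \<le> d" "d < 2 * 2 powi k"
    using assms by (simp_all add: powr_add powr_real_of_int' mult.commute)
  define t where "t = d / 2 powi k"
  have t: "1 \<le> t" "t < 2"
    using k by (simp_all add: t_def pos_le_divide_eq pos_divide_less_eq)
  show thesis
  proof (cases "t \<le> 3 / 2")
    case True
    then have "1 / 2 \<le> bump (d / 2 powi k)"
      unfolding t_def [symmetric] bump_def using t by auto
    then show thesis by (rule that)
  next
    case False
    have half: "d / 2 powi (k + 1) = t / 2"
      by (simp add: t_def power_int_add)
    have "1 / 2 \<le> bump (d / 2 powi (k + 1))"
      unfolding half bump_def using False t by auto
    then show thesis by (rule that)
  qed
qed

lemma powi_two_less: "2 powi j < 4 * (2 powi k :: real) \<Longrightarrow> j < k + 2"
  using power_int_increasing [of "k + 2" j "2 :: real"]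
  by (cases "k + 2 \<le> j") (auto simp: power_int_add)

lemma norm_cis_diff: "norm (cis a - cis b) = 2 * \<bar>sin ((a - b) / 2)\<bar>"
proof -
  have "(norm (cis a - cis b))\<^sup>2 = (cos a - cos b)\<^sup>2 + (sin a - sin b)\<^sup>2"
    by (simp add: cmod_power2)
  also have "\<dots> = ((cos a)\<^sup>2 + (sin a)\<^sup>2) + ((cos b)\<^sup>2 + (sin b)\<^sup>2) - 2 * cos (a - b)"
    unfolding cos_diff by (simp add: power2_eq_square algebra_simps)
  also have "\<dots> = (2 * \<bar>sin ((a - b) / 2)\<bar>)\<^sup>2"
  proof -
    have "2 * ((a - b) / 2) = a - b" by simp
    then have "cos (a - b) = 1 - 2 * (sin ((a - b) / 2))\<^sup>2"
      using cos_double_sin [of "(a - b) / 2"] by metis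
    then show ?thesis
      by (simp add: power_mult_distrib)
  qed
  finally show ?thesis
    by (rule power2_eq_imp_eq) auto
qed

lemma norm_cis_diff_le: "norm (cis a - cis b) \<le> \<bar>a - b\<bar>"
  using abs_sin_x_le_abs_x [of "(a - b) / 2"] by (simp add: norm_cis_diff)

lemma norm_cis_diff_ge:
  assumes "\<bar>a - b\<bar> \<le> 1"
  shows "\<bar>a - b\<bar> / 2 \<le> norm (cis a - cis b)"
proof -
  define t where "t = (a - b) / 2"
  have t: "\<bar>t\<bar> \<le> 1 / 2"
    using assms by (simp add: t_def)
  have "\<bar>sin t - t\<bar> \<le> t\<^sup>2 / 2"
    using Maclaurin_sin_bound [of t 2] by (simp add: sin_coeff_def numeral_2_eq_2)
  moreover have "t\<^sup>2 \<le> \<bar>t\<bar> * (1 / 2)"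
    using mult_left_mono [OF t, of "\<bar>t\<bar>"] by (simp add: power2_eq_square)
  ultimately have "\<bar>t\<bar> / 2 \<le> \<bar>sin t\<bar>"
    by argo
  moreover have "\<bar>a - b\<bar> = 2 * \<bar>t\<bar>"
    by (simp add: t_def)
  ultimately show ?thesis
    unfolding norm_cis_diff t_def [symmetric] by argo
qed

text \<open>
  Vectors in different directions stay apart however their lengths are chosen: passing to equal lengths
  costs the difference of the lengths, which is itself at most the distance of the vectors.
\<close>

lemma norm_polar_diff_ge:
  fixes u v :: complex
  assumes "norm u = 1" "norm v = 1" "0 \<le> s" "0 \<le> t"
  shows "s * norm (u - v) / 2 \<le> norm (of_real s * u - of_real t * v)"
proof -
  have "\<bar>s - t\<bar> = \<bar>norm (of_real s * u) - norm (of_real t * v)\<bar>"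
    using assms by (simp add: norm_mult)
  also have "\<dots> \<le> norm (of_real s * u - of_real t * v)"
    by (rule norm_triangle_ineq3)
  finally have 1: "\<bar>s - t\<bar> \<le> norm (of_real s * u - of_real t * v)" .
  have "s * norm (u - v) = norm (of_real s * (u - v))"
    using assms by (simp add: norm_mult)
  also have "of_real s * (u - v) = (of_real s * u - of_real t * v) + of_real (t - s) * v"
    by (simp add: algebra_simps)
  also have "norm \<dots> \<le> norm (of_real s * u - of_real t * v) + norm (of_real (t - s) * v)"
    by (rule norm_triangle_ineq)
  also have "norm (of_real (t - s) * v) = \<bar>s - t\<bar>"
    using assms by (simp add: norm_mult abs_minus_commute del: of_real_diff)
  finally show ?thesis
    using 1 by simp
qed

text \<open>
  Concatenates a point of \<open>\<real>\<^sup>n\<close> and \<open>K\<close> complex numbers to a point of \<open>\<real>\<^bsup>n + 2 K\<^esup>\<close>, real and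
  imaginary parts at even and odd offsets.
\<close>

definition assemble :: "nat \<Rightarrow> nat \<Rightarrow> (nat \<Rightarrow> real) \<Rightarrow> (nat \<Rightarrow> complex) \<Rightarrow> nat \<Rightarrow> real" where
  "assemble n K u h i =
     (if i < n then u i
      else if i < n + 2 * K then (if even (i - n) then Re (h ((i - n) div 2)) else Im (h ((i - n) div 2)))
      else 0)"

lemma ndist_assemble_square:
  "(ndist (n + 2 * K) (assemble n K u h) (assemble n K v j))\<^sup>2
     = (ndist n u v)\<^sup>2 + (\<Sum>c<K. (norm (h c - j c))\<^sup>2)"
proof -
  let ?G = "\<lambda>i. (assemble n K u h i - assemble n K v j i)\<^sup>2"
  have "sum ?G {..<n + 2 * L} = (\<Sum>i<n. (u i - v i)\<^sup>2) + (\<Sum>c<L. (norm (h c - j c))\<^sup>2)" if "L \<le> K" for L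
    using that
  proof (induction L)
    case 0
    show ?case
      by (simp add: assemble_def)
  next
    case (Suc L)
    have "?G (n + 2 * L) + ?G (Suc (n + 2 * L)) = (norm (h L - j L))\<^sup>2"
      using Suc.prems by (simp add: assemble_def cmod_power2)
    then show ?case
      using Suc by simp
  qed
  from this [of K] show ?thesis
    by (simp add: L2_set_def sum_nonneg)
qed

lemma ndist_assemble_le:
  "ndist (n + 2 * K) (assemble n K u h) (assemble n K v j) \<le> ndist n u v + (\<Sum>c<K. norm (h c - j c))"
proof -
  have "(ndist (n + 2 * K) (assemble n K u h) (assemble n K v j))\<^sup>2
      = (ndist n u v)\<^sup>2 + (L2_set (\<lambda>c. norm (h c - j c)) {..<K})\<^sup>2"
    unfolding ndist_assemble_square by (simp add: L2_set_def sum_nonneg)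
  then have "ndist (n + 2 * K) (assemble n K u h) (assemble n K v j)
      = sqrt ((ndist n u v)\<^sup>2 + (L2_set (\<lambda>c. norm (h c - j c)) {..<K})\<^sup>2)"
    by (metis L2_set_nonneg real_sqrt_unique)
  also have "\<dots> \<le> ndist n u v + L2_set (\<lambda>c. norm (h c - j c)) {..<K}"
    by (rule sqrt_sum_squares_le_sum) auto
  finally show ?thesis
    using L2_set_le_sum [of "{..<K}" "\<lambda>c. norm (h c - j c)"] by simp
qed

lemma ndist_le_ndist_assemble:
  "ndist n u v \<le> ndist (n + 2 * K) (assemble n K u h) (assemble n K v j)"
  by (rule power2_le_imp_le) (simp_all add: ndist_assemble_square sum_nonneg)

lemma norm_le_ndist_assemble:
  assumes "c < K"
  shows "norm (h c - j c) \<le> ndist (n + 2 * K) (assemble n K u h) (assemble n K v j)"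
proof (rule power2_le_imp_le)
  have "(norm (h c - j c))\<^sup>2 \<le> (\<Sum>c<K. (norm (h c - j c))\<^sup>2)"
    using assms by (intro member_le_sum) auto
  then show "(norm (h c - j c))\<^sup>2 \<le> (ndist (n + 2 * K) (assemble n K u h) (assemble n K v j))\<^sup>2"
    unfolding ndist_assemble_square by (simp add: add_increasing)
qed simp

section \<open>Construction of the extension\<close>

context qs_gauge
begin

lemma \<theta>_mono: "0 \<le> s \<Longrightarrow> s \<le> t \<Longrightarrow> \<theta> s \<le> \<theta> t"
  by (rule modulus_mono [OF modulus])

lemma \<theta>_nonneg: "0 \<le> t \<Longrightarrow> 0 \<le> \<theta> t"
  by (rule modulus_nonneg [OF modulus])

lemma C_pos: "0 < C"
  using C_ge_1 by simp

text \<open>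
  The growth condition with equal radii forces \<open>1 \<le> \<theta> 1\<close>.
\<close>

lemma \<theta>_ge_1:
  assumes "E \<noteq> {}" "1 \<le> t"
  shows "1 \<le> \<theta> t"
proof -
  obtain x where x: "x \<in> E"
    using assms(1) by blast
  have "1 \<le> \<theta> 1"
    using gauge_scale [OF x, of 1 1] gauge_pos [OF x, of 1] by simp
  also have "\<dots> \<le> \<theta> t"
    using assms(2) by (intro \<theta>_mono) auto
  finally show ?thesis .
qed

lemma gauge_compare:
  assumes x: "x \<in> E" and y: "y \<in> E" and s: "0 < s" and t: "0 < t"
    and A: "1 \<le> A" and near: "\<bar>x - y\<bar> \<le> A * t"
  shows "\<omega> x s \<le> C * \<theta> A * \<theta> (s / t) * \<omega> y t"
proof -
  have At: "0 < A * t"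
    using A t by simp
  have "\<omega> x s \<le> \<theta> (s / (A * t)) * \<omega> x (A * t)"
    by (rule gauge_scale [OF x s At])
  also have "\<dots> \<le> \<theta> (s / t) * (C * (\<theta> A * \<omega> y t))"
  proof (intro mult_mono)
    have "s / (A * t) \<le> s / t"
      using s t A by (intro divide_left_mono) (auto simp: mult_le_cancel_right1)
    then show "\<theta> (s / (A * t)) \<le> \<theta> (s / t)"
      using s At by (intro \<theta>_mono) auto
    have "\<omega> y (A * t) \<le> \<theta> A * \<omega> y t"
      using gauge_scale [OF y At t] t by simp
    then show "\<omega> x (A * t) \<le> C * (\<theta> A * \<omega> y t)"
      using gauge_centre [OF x y At near] C_pos by (meson order_trans mult_left_mono less_imp_le)
    show "0 \<le> \<theta> (s / t)"
      using s t by (intro \<theta>_nonneg) auto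
    show "0 \<le> \<omega> x (A * t)"
      using gauge_pos [OF x At] by simp
  qed
  finally show ?thesis
    by (simp add: mult_ac)
qed

lemma ndist_gauge_compare:
  assumes x: "x \<in> E" and y: "y \<in> E" and t: "0 < t" and D: "\<bar>x - y\<bar> \<le> D"
  shows "ndist n (f y) (f x) \<le> C * \<theta> (D / t) * \<omega> x t"
proof (cases "x = y")
  case True
  then show ?thesis
    using \<theta>_nonneg [of "D / t"] gauge_pos [OF x t] C_pos t D by (simp add: L2_set_def)
next
  case False
  have "ndist n (f y) (f x) \<le> C * \<omega> x \<bar>x - y\<bar>"
    using ndist_le_gauge [OF x y False] ndist_commute [of "f x" "f y" n] by simp
  also have "\<dots> \<le> C * (\<theta> (\<bar>x - y\<bar> / t) * \<omega> x t)"
    using gauge_scale [OF x _ t, of "\<bar>x - y\<bar>"] False C_pos by (intro mult_left_mono) auto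
  also have "\<dots> \<le> C * (\<theta> (D / t) * \<omega> x t)"
    using D t C_pos gauge_pos [OF x t]
    by (intro mult_left_mono mult_right_mono \<theta>_mono divide_right_mono) auto
  finally show ?thesis
    by (simp add: mult_ac)
qed

end

text \<open>
  \<open>N\<close> separates the far pairs, \<open>N \<delta> x \<le> \<bar>x - y\<bar>\<close>, from the near pairs. The condition on \<open>N\<close> makes the
  deviation of \<open>g\<close> from \<open>f\<close> at far pairs at most half of the distance of the images of the feet. The condition on
  \<open>K\<close> makes the amplitude at a scale at most \<open>2 \<delta> x / 2\<^sup>K\<close> within distance \<open>(N + 1) \<delta> x\<close> of the foot at most
  half of the height of the wave at \<open>x\<close> in a scale at which the bump is at least \<open>1 / 2\<close>.
\<close>

locale gauge_extension = qs_gauge +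
  fixes N :: real and K :: nat
  assumes closed: "closed E" and nonempty: "E \<noteq> {}"
    and N_ge_4: "4 \<le> N" and K_ge_2: "2 \<le> K"
    and N_large: "2 * C * \<theta> 2 * (C * \<theta> (3 / N) * (1 + C * \<theta> 2 * \<theta> 1)) \<le> 1"
    and K_large: "4 * (C * \<theta> 6 * \<theta> 2) * (C * \<theta> (3 * (N + 1)) * \<theta> (2 / 2 ^ K)) \<le> 1"
begin

abbreviation "\<delta> x \<equiv> infdist x E"
abbreviation "wt x \<equiv> gap_weight E x"
abbreviation "lft x \<equiv> gap_left E x"
abbreviation "rgt x \<equiv> gap_right E x"

definition g :: "real \<Rightarrow> nat \<Rightarrow> real" where
  "g x = (\<lambda>i. blend (wt x) (f (lft x) i) (f (rgt x) i))"

definition amplitude :: "int \<Rightarrow> real \<Rightarrow> real" where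
  "amplitude k x = blend (wt x) (\<omega> (lft x) (2 powi k)) (\<omega> (rgt x) (2 powi k))"

text \<open>
  The contribution of the dyadic scale \<open>2\<^sup>k\<close>. The phase is slow enough to stay injective on pairs at distance
  less than \<open>N \<delta> x\<close>, since \<open>\<delta> x < 2 * 2\<^sup>k\<close> on the support of the wave.
\<close>

definition wave :: "int \<Rightarrow> real \<Rightarrow> complex" where
  "wave k x = of_real (bump (\<delta> x / 2 powi k) * amplitude k x) * cis (x / (2 * N * 2 powi k))"

lemma N_pos: "0 < N"
  using N_ge_4 by simp

lemma one_le_\<theta>: "1 \<le> t \<Longrightarrow> 1 \<le> \<theta> t"
  using \<theta>_ge_1 [OF nonempty] .

lemma lft_mem: "lft x \<in> E" and rgt_mem: "rgt x \<in> E"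
  using gap_ends_mem [OF closed nonempty] by blast+

text \<open>
  Measured from any point \<open>q\<close> of \<open>E\<close>, the ends that carry weight at \<open>x\<close> are as close as \<open>x\<close> itself, up
  to a factor. So all quantities interpolated at \<open>x\<close> can be compared with the gauge at \<open>q\<close>.
\<close>

lemma left_near:
  assumes "q \<in> E" "wt x < 1"
  shows "\<bar>q - lft x\<bar> \<le> 3 * \<bar>x - q\<bar>"
  using gap_left_close [OF closed nonempty assms(2)] infdist_le_abs [OF assms(1), of x] by argo

lemma right_near:
  assumes "q \<in> E" "0 < wt x"
  shows "\<bar>q - rgt x\<bar> \<le> 3 * \<bar>x - q\<bar>"
  using gap_right_close [OF closed nonempty assms(2)] infdist_le_abs [OF assms(1), of x] by argo

lemma g_near:
  assumes q: "q \<in> E" and t: "0 < t"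
  shows "ndist n (g x) (f q) \<le> C * \<theta> (3 * \<bar>x - q\<bar> / t) * \<omega> q t"
  unfolding g_def
proof (intro ndist_blend_le gap_weight_range)
  show "ndist n (f (lft x)) (f q) \<le> C * \<theta> (3 * \<bar>x - q\<bar> / t) * \<omega> q t" if "wt x < 1"
    by (rule ndist_gauge_compare [OF q lft_mem t left_near [OF q that]])
  show "ndist n (f (rgt x)) (f q) \<le> C * \<theta> (3 * \<bar>x - q\<bar> / t) * \<omega> q t" if "0 < wt x"
    by (rule ndist_gauge_compare [OF q rgt_mem t right_near [OF q that]])
qed

lemma amplitude_le:
  assumes q: "q \<in> E" and t: "0 < t" and A: "1 \<le> A" "3 * \<bar>x - q\<bar> \<le> A * t"
  shows "amplitude k x \<le> C * \<theta> A * \<theta> (2 powi k / t) * \<omega> q t"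
  unfolding amplitude_def
proof (intro blend_le gap_weight_range)
  show "\<omega> (lft x) (2 powi k) \<le> C * \<theta> A * \<theta> (2 powi k / t) * \<omega> q t" if "wt x < 1"
    using left_near [OF q that] A(2) t
    by (intro gauge_compare [OF lft_mem q _ t A(1)]) (auto simp: abs_minus_commute)
  show "\<omega> (rgt x) (2 powi k) \<le> C * \<theta> A * \<theta> (2 powi k / t) * \<omega> q t" if "0 < wt x"
    using right_near [OF q that] A(2) t
    by (intro gauge_compare [OF rgt_mem q _ t A(1)]) (auto simp: abs_minus_commute)
qed

lemma le_amplitude:
  assumes q: "q \<in> E" and t: "0 < t" and A: "1 \<le> A" "3 * \<bar>x - q\<bar> \<le> A * 2 powi k"
  shows "\<omega> q t \<le> C * \<theta> A * \<theta> (t / 2 powi k) * amplitude k x"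
proof -
  let ?c = "C * \<theta> A * \<theta> (t / 2 powi k)"
  have eq: "?c * amplitude k x = blend (wt x) (?c * \<omega> (lft x) (2 powi k)) (?c * \<omega> (rgt x) (2 powi k))"
    by (simp add: amplitude_def blend_def algebra_simps)
  show ?thesis
    unfolding eq
  proof (intro le_blend gap_weight_range)
    show "\<omega> q t \<le> ?c * \<omega> (lft x) (2 powi k)" if "wt x < 1"
      using left_near [OF q that] A(2) by (intro gauge_compare [OF q lft_mem t _ A(1)]) auto
    show "\<omega> q t \<le> ?c * \<omega> (rgt x) (2 powi k)" if "0 < wt x"
      using right_near [OF q that] A(2) by (intro gauge_compare [OF q rgt_mem t _ A(1)]) auto
  qed
qed

lemma amplitude_pos: "0 \<le> amplitude k x"
  unfolding amplitude_def
  by (intro le_blend gap_weight_range less_imp_le gauge_pos lft_mem rgt_mem) auto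

lemma norm_wave: "norm (wave k x) = bump (\<delta> x / 2 powi k) * amplitude k x"
  using bump_range(1) amplitude_pos by (simp add: wave_def norm_mult)

lemma norm_wave_le: "norm (wave k x) \<le> amplitude k x"
  using mult_right_mono [OF bump_range(2) amplitude_pos] by (simp add: norm_wave)

lemma wave_support:
  assumes "wave k x \<noteq> 0"
  shows "\<delta> x < 2 * 2 powi k" "2 powi k < 2 * \<delta> x"
proof -
  have "bump (\<delta> x / 2 powi k) \<noteq> 0"
    using assms by (auto simp: wave_def)
  from bump_support [OF this] show "\<delta> x < 2 * 2 powi k" "2 powi k < 2 * \<delta> x"
    by (auto simp: pos_less_divide_eq pos_divide_less_eq)
qed

lemma wave_scales_close:
  assumes "wave j x \<noteq> 0" "wave k x \<noteq> 0"
  shows "j < k + 2"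
  using wave_support [OF assms(1)] wave_support [OF assms(2)] by (intro powi_two_less) argo

text \<open>
  At each point the waves of at most two consecutive scales are nonzero. Hence each residue class modulo \<open>K\<close>
  contains at most one of them, and its plane carries only this wave.
\<close>

definition active_scale :: "nat \<Rightarrow> real \<Rightarrow> int" where
  "active_scale c x = (SOME k. k mod int K = int c \<and>
     (\<forall>j. j mod int K = int c \<longrightarrow> j \<noteq> k \<longrightarrow> wave j x = 0))"

definition h :: "real \<Rightarrow> nat \<Rightarrow> complex" where
  "h x c = wave (active_scale c x) x"

lemma cong_far:
  assumes "j mod int K = k mod int K" "j \<noteq> k"
  shows "int K \<le> \<bar>j - k\<bar>"
proof -
  have "int K dvd \<bar>j - k\<bar>"
    using assms(1) by (simp add: mod_eq_dvd_iff)
  then show ?thesis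
    using assms(2) by (intro zdvd_imp_le) auto
qed

lemma active_scale:
  assumes c: "c < K"
  shows "active_scale c x mod int K = int c"
    and "j mod int K = int c \<Longrightarrow> j \<noteq> active_scale c x \<Longrightarrow> wave j x = 0"
proof -
  have "\<exists>k. k mod int K = int c \<and> (\<forall>j. j mod int K = int c \<longrightarrow> j \<noteq> k \<longrightarrow> wave j x = 0)"
  proof (cases "\<exists>k. k mod int K = int c \<and> wave k x \<noteq> 0")
    case True
    then obtain k where k: "k mod int K = int c" "wave k x \<noteq> 0"
      by blast
    have "wave j x = 0" if "j mod int K = int c" "j \<noteq> k" for j
    proof (rule ccontr)
      assume j: "wave j x \<noteq> 0"
      have "int K \<le> \<bar>j - k\<bar>"
        using cong_far [of j k] that k(1) by simp
      then show False
        using wave_scales_close [OF j k(2)] wave_scales_close [OF k(2) j] K_ge_2 by linarith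
    qed
    with k show ?thesis by blast
  next
    case False
    then have "\<forall>j. j mod int K = int c \<longrightarrow> wave j x = 0"
      by blast
    moreover have "int c mod int K = int c"
      using c by simp
    ultimately show ?thesis by blast
  qed
  from someI_ex [OF this]
  show "active_scale c x mod int K = int c"
    and "j mod int K = int c \<Longrightarrow> j \<noteq> active_scale c x \<Longrightarrow> wave j x = 0"
    unfolding active_scale_def by blast+
qed

lemma h_eq_wave:
  assumes "wave k x \<noteq> 0"
  shows "h x (nat (k mod int K)) = wave k x"
proof -
  have c: "nat (k mod int K) < K" "int (nat (k mod int K)) = k mod int K"
    using K_ge_2 by (auto simp: nat_less_iff)
  have "k = active_scale (nat (k mod int K)) x"
    using active_scale(2) [OF c(1), of k x] assms c(2) by metis
  then show ?thesis
    unfolding h_def by simp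
qed

text \<open>
  If the active scales at \<open>x\<close> and \<open>y\<close> differ, then each of the two waves vanishes at the other point.
\<close>

lemma norm_h_diff_le:
  assumes c: "c < K" and "\<And>k. norm (wave k x - wave k y) \<le> b"
  shows "norm (h x c - h y c) \<le> 2 * b"
proof -
  let ?k = "active_scale c x" and ?k' = "active_scale c y"
  have b: "0 \<le> b"
    using assms(2) [of 0] norm_ge_zero order_trans by blast
  show ?thesis
  proof (cases "?k = ?k'")
    case True
    then show ?thesis
      using assms(2) [of ?k] b by (simp add: h_def)
  next
    case False
    have "wave ?k y = 0" "wave ?k' x = 0"
      using active_scale(2) [OF c, of ?k y] active_scale(2) [OF c, of ?k' x] active_scale(1) [OF c] False
      by auto
    then have "norm (wave ?k x) \<le> b" "norm (wave ?k' y) \<le> b"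
      using assms(2) [of ?k] assms(2) [of ?k'] by simp_all
    then show ?thesis
      unfolding h_def using norm_triangle_ineq4 [of "wave ?k x" "wave ?k' y"] by linarith
  qed
qed

definition foot :: "real \<Rightarrow> real" where
  "foot x = (SOME p. p \<in> E \<and> \<delta> x = \<bar>x - p\<bar>)"

lemma foot: "foot x \<in> E" "\<bar>x - foot x\<bar> = \<delta> x"
proof -
  have "\<exists>p. p \<in> E \<and> \<delta> x = \<bar>x - p\<bar>"
    using infdist_attained_real [OF closed nonempty] by metis
  from someI_ex [OF this] show "foot x \<in> E" "\<bar>x - foot x\<bar> = \<delta> x"
    unfolding foot_def by simp_all
qed

text \<open>
  The gauge with an arbitrary centre: below the distance to \<open>E\<close> it is linear in \<open>r\<close>, above this distance it is
  the gauge at the foot.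
\<close>

definition scale_at :: "real \<Rightarrow> real \<Rightarrow> real" where
  "scale_at x r = \<omega> (foot x) (max r (\<delta> x)) * (r / max r (\<delta> x))"

lemma scale_at_pos: "0 < r \<Longrightarrow> 0 < scale_at x r"
  unfolding scale_at_def using gauge_pos [OF foot(1)] by simp

lemma scale_at_growth:
  assumes s: "0 < s" and t: "0 < t"
  shows "scale_at x s \<le> warp 1 \<theta> (s / t) * scale_at x t"
proof -
  let ?m = "max s (\<delta> x)" and ?m' = "max t (\<delta> x)"
  have m: "0 < ?m" "0 < ?m'"
    using s t by auto
  have \<delta>: "0 \<le> \<delta> x" by (rule infdist_nonneg)
  have ratio: "\<theta> (?m / ?m') * ((s / t) / (?m / ?m')) \<le> warp 1 \<theta> (s / t)"
  proof (rule warp_bound [OF modulus])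
    assume "s / t \<le> 1"
    then have "s \<le> t" using t by simp
    then have "s * ?m' \<le> ?m * t"
      using s t \<delta> by (auto simp: max_def mult.commute intro!: mult_mono)
    with \<open>s \<le> t\<close> show "s / t \<le> 1 * (?m / ?m') \<and> ?m / ?m' \<le> 1"
      using m t by (auto simp: field_simps)
  next
    assume "1 \<le> s / t"
    then have "t \<le> s" using t by simp
    then have "?m * t \<le> s * ?m'"
      using s t \<delta> by (auto simp: max_def mult.commute intro!: mult_mono)
    with \<open>t \<le> s\<close> show "1 \<le> 1 * (?m / ?m') \<and> ?m / ?m' \<le> 1 * (s / t)"
      using m t by (auto simp: field_simps)
  qed (use s t m in auto)
  have "scale_at x s \<le> (\<theta> (?m / ?m') * \<omega> (foot x) ?m') * (s / ?m)"
    unfolding scale_at_def using gauge_scale [OF foot(1) m, of x] s m by (intro mult_right_mono) auto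
  also have "\<dots> = (\<theta> (?m / ?m') * ((s / t) / (?m / ?m'))) * scale_at x t"
    unfolding scale_at_def using m s t by (simp add: field_simps)
  also have "\<dots> \<le> warp 1 \<theta> (s / t) * scale_at x t"
    using ratio scale_at_pos [OF t, of x] by (intro mult_right_mono) auto
  finally show ?thesis .
qed

end

section \<open>Comparison of distances with the gauge\<close>

text \<open>
  The constants of the two-sided comparison of distances with \<open>scale_at\<close>. They involve \<open>\<theta>\<close>, \<open>C\<close>, \<open>N\<close> and \<open>K\<close>,
  but neither \<open>f\<close> nor the dimension.
\<close>

definition upper_const :: "(real \<Rightarrow> real) \<Rightarrow> real \<Rightarrow> real" where
  "upper_const \<theta> C = C * \<theta> 6 * \<theta> 4"

definition lower_const :: "(real \<Rightarrow> real) \<Rightarrow> real \<Rightarrow> real \<Rightarrow> real" where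
  "lower_const \<theta> C N =
     2 * C * \<theta> 2 + 2 * (C * \<theta> (N + 2) * \<theta> N) * (32 * N * (C * \<theta> 6 * \<theta> 2))"

definition distortion :: "(real \<Rightarrow> real) \<Rightarrow> real \<Rightarrow> real \<Rightarrow> nat \<Rightarrow> real" where
  "distortion \<theta> C N K = (real K + 1) * (22 * upper_const \<theta> C) * lower_const \<theta> C N"

context gauge_extension
begin

abbreviation "cst \<equiv> upper_const \<theta> C"

lemma cst_ge: "C * \<theta> s \<le> cst" "C * \<theta> s * \<theta> t \<le> cst" if "0 \<le> s" "s \<le> 6" "0 \<le> t" "t \<le> 4"
proof -
  have *: "0 \<le> \<theta> s" "\<theta> s \<le> \<theta> 6" "0 \<le> \<theta> t" "\<theta> t \<le> \<theta> 4" "1 \<le> \<theta> 4" "0 < C"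
    using that by (auto intro: \<theta>_mono \<theta>_nonneg one_le_\<theta> C_pos)
  show "C * \<theta> s * \<theta> t \<le> cst"
    unfolding upper_const_def using * by (intro mult_mono) auto
  have "(C * \<theta> s) * 1 \<le> (C * \<theta> 6) * \<theta> 4"
    using * by (intro mult_mono) auto
  then show "C * \<theta> s \<le> cst"
    by (simp add: upper_const_def)
qed

lemma cst_pos: "0 \<le> cst"
  using C_pos \<theta>_nonneg by (simp add: upper_const_def)

definition separation :: "real \<Rightarrow> real \<Rightarrow> real" where
  "separation x y = ndist n (g x) (g y) + (\<Sum>c<K. norm (h x c - h y c))"

lemma separation_le:
  assumes "ndist n (g x) (g y) \<le> b" "\<And>c. c < K \<Longrightarrow> norm (h x c - h y c) \<le> b"
  shows "separation x y \<le> (real K + 1) * b"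
proof -
  have "(\<Sum>c<K. norm (h x c - h y c)) \<le> real K * b"
    using sum_bounded_above [of "{..<K}" "\<lambda>c. norm (h x c - h y c)" b] assms(2) by simp
  then show ?thesis
    using assms(1) by (simp add: separation_def distrib_right)
qed

text \<open>
  Both points are within \<open>2 t\<close> of the foot of \<open>x\<close>, where \<open>t\<close> is comparable with their distance; so \<open>g\<close>
  deviates from the image of the foot, and \<open>h\<close> from \<open>0\<close>, by at most a multiple of the gauge at radius \<open>t\<close>.
\<close>

lemma separation_upper_far:
  assumes r: "r = \<bar>x - y\<bar>" "0 < r" and far: "\<delta> x \<le> 2 * r"
  shows "separation x y \<le> (real K + 1) * (4 * cst * scale_at x r)"
proof (rule separation_le)
  define p where "p = foot x"
  define t where "t = max r (\<delta> x)"
  define W where "W = \<omega> p t"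
  have p: "p \<in> E" and xp: "\<bar>x - p\<bar> = \<delta> x"
    using foot by (simp_all add: p_def)
  have t: "0 < t" "r \<le> t" "\<delta> x \<le> t" "t \<le> 2 * r"
    using r far by (auto simp: t_def)
  have yp: "\<bar>y - p\<bar> \<le> 2 * t"
    using t xp r(1) by argo
  have W: "0 < W"
    using gauge_pos [OF p t(1)] by (simp add: W_def)
  have scale_at: "scale_at x r = W * (r / t)"
    by (simp add: scale_at_def W_def p_def t_def)
  have half: "W * (1 / 2) \<le> W * (r / t)"
    using W t by (intro mult_left_mono) (auto simp: field_simps)
  have "2 * (cst * W) = (4 * cst) * (W * (1 / 2))"
    by simp
  also have "\<dots> \<le> (4 * cst) * (W * (r / t))"
    using cst_pos by (intro mult_left_mono [OF half]) simp
  finally have final: "2 * (cst * W) \<le> 4 * cst * scale_at x r"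
    by (simp only: scale_at)
  have g_bound: "ndist n (g z) (f p) \<le> cst * W" if "\<bar>z - p\<bar> \<le> 2 * t" for z
  proof -
    have "3 * \<bar>z - p\<bar> / t \<le> 6"
      using that t by (simp add: pos_divide_le_eq)
    then have "C * \<theta> (3 * \<bar>z - p\<bar> / t) \<le> cst"
      using t by (intro cst_ge [of _ 4]) auto
    then have "C * \<theta> (3 * \<bar>z - p\<bar> / t) * W \<le> cst * W"
      using W by (intro mult_right_mono) auto
    then show ?thesis
      using g_near [OF p t(1), of z] by (simp add: W_def)
  qed
  have wave_bound: "norm (wave k z) \<le> cst * W" if z: "\<bar>z - p\<bar> \<le> 2 * t" for k z
  proof (cases "wave k z = 0")
    case True
    then show ?thesis
      using cst_pos W by simp
  next
    case False
    have "2 powi k < 2 * \<delta> z" "\<delta> z \<le> \<bar>z - p\<bar>"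
      using wave_support [OF False] infdist_le_abs [OF p] by auto
    then have "2 powi k / t \<le> 4"
      using z t by (simp add: pos_divide_le_eq)
    then have "C * \<theta> 6 * \<theta> (2 powi k / t) \<le> cst"
      using t by (intro cst_ge) auto
    then have "C * \<theta> 6 * \<theta> (2 powi k / t) * W \<le> cst * W"
      using W by (intro mult_right_mono) auto
    moreover have "amplitude k z \<le> C * \<theta> 6 * \<theta> (2 powi k / t) * W"
      unfolding W_def using z by (intro amplitude_le [OF p t(1)]) auto
    ultimately show ?thesis
      using norm_wave_le [of k z] by linarith
  qed
  have xz: "\<bar>x - p\<bar> \<le> 2 * t"
    using xp t infdist_nonneg [of x E] by linarith
  show "ndist n (g x) (g y) \<le> 4 * cst * scale_at x r"
    using ndist_triangle [of "g x" "g y" n "f p"] ndist_commute [of "f p" "g y" n]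
      g_bound [OF xz] g_bound [OF yp] final by linarith
  show "norm (h x c - h y c) \<le> 4 * cst * scale_at x r" for c
    using norm_triangle_ineq4 [of "h x c" "h y c"] wave_bound [OF xz, of "active_scale c x"]
      wave_bound [OF yp, of "active_scale c y"] final
    unfolding h_def by linarith
qed

text \<open>
  Both points lie in the same gap, at comparable distances from \<open>E\<close>. There all ingredients are Lipschitz
  on the scale \<open>\<delta> x\<close>: the weight, the bump and the phase change by a multiple of \<open>T = r / \<delta> x\<close>, while the
  amplitudes, and the images of the two ends if the weight changes at all, are bounded by the gauge.
\<close>

lemma separation_upper_near:
  assumes r: "r = \<bar>x - y\<bar>" "0 < r" and near: "2 * r < \<delta> x"
  shows "separation x y \<le> (real K + 1) * (22 * cst * scale_at x r)"
proof (rule separation_le)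
  define p where "p = foot x"
  define W where "W = \<omega> p (\<delta> x)"
  define T where "T = r / \<delta> x"
  have p: "p \<in> E" and xp: "\<bar>x - p\<bar> = \<delta> x"
    using foot by (simp_all add: p_def)
  have \<delta>: "0 < \<delta> x"
    using r near by linarith
  have W: "0 < W"
    using gauge_pos [OF p \<delta>] by (simp add: W_def)
  have T: "0 < T"
    using r \<delta> by (simp add: T_def)
  have scale_at: "scale_at x r = W * T"
  proof -
    have "max r (\<delta> x) = \<delta> x"
      using near r(2) by simp
    then show ?thesis
      by (simp add: scale_at_def W_def p_def T_def)
  qed
  have \<delta>y: "\<delta> x \<le> 2 * \<delta> y" "2 * \<delta> y \<le> 3 * \<delta> x"
    using infdist_lipschitz [of x E y] near r by argo+
  have "\<bar>x - y\<bar> < \<delta> x"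
    using r near by argo
  note gap = same_gap [OF closed nonempty this]
  have \<Delta>w: "\<bar>wt x - wt y\<bar> \<le> 2 * T"
    using gap(3) \<delta> r by (simp add: T_def pos_le_divide_eq)
  have ends: "\<bar>p - lft x\<bar> \<le> 5 * \<delta> x \<and> \<bar>p - rgt x\<bar> \<le> 5 * \<delta> x" if "wt x \<noteq> wt y"
  proof
    have "wt x < 1 \<or> wt y < 1" "0 < wt x \<or> 0 < wt y"
      using that gap_weight_range[of E x] gap_weight_range[of E y] by linarith+
    then have "\<bar>x - lft x\<bar> \<le> 2 * \<delta> x \<or> \<bar>y - lft x\<bar> \<le> 2 * \<delta> y"
      "\<bar>x - rgt x\<bar> \<le> 2 * \<delta> x \<or> \<bar>y - rgt x\<bar> \<le> 2 * \<delta> y"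
      using gap_left_close [OF closed nonempty, of x] gap_left_close [OF closed nonempty, of y]
        gap_right_close [OF closed nonempty, of x] gap_right_close [OF closed nonempty, of y]
      unfolding gap by blast+
    then show "\<bar>p - lft x\<bar> \<le> 5 * \<delta> x" "\<bar>p - rgt x\<bar> \<le> 5 * \<delta> x"
      using xp r near \<delta>y by argo+
  qed
  have times: "a * W \<le> cst * W" if "a \<le> cst" for a
    using that W by (intro mult_right_mono) auto
  have "ndist n (g x) (g y) = \<bar>wt x - wt y\<bar> * ndist n (f (lft x)) (f (rgt x))"
    unfolding g_def gap by (rule ndist_blend_blend)
  also have "\<dots> \<le> (2 * T) * (2 * (cst * W))"
  proof (cases "wt x = wt y")
    case True
    then show ?thesis
      using T W cst_pos by simp
  next
    case False
    have "ndist n (f z) (f p) \<le> cst * W" if "z \<in> E" "\<bar>p - z\<bar> \<le> 5 * \<delta> x" for z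
    proof -
      have "ndist n (f z) (f p) \<le> C * \<theta> (5 * \<delta> x / \<delta> x) * W"
        unfolding W_def by (rule ndist_gauge_compare [OF p that(1) \<delta> that(2)])
      also have "\<dots> \<le> cst * W"
        using \<delta> cst_ge(1) [of 5 4] by (intro times) simp
      finally show ?thesis .
    qed
    from this [OF lft_mem, of x] this [OF rgt_mem, of x]
    have "ndist n (f (lft x)) (f (rgt x)) \<le> 2 * (cst * W)"
      using ends [OF False] ndist_triangle [of "f (lft x)" "f (rgt x)" n "f p"]
        ndist_commute [of "f p" "f (rgt x)" n] by linarith
    with \<Delta>w show ?thesis
      using T by (intro mult_mono) auto
  qed
  also have "\<dots> = 4 * cst * scale_at x r"
    by (simp add: scale_at)
  also have "\<dots> \<le> 22 * cst * scale_at x r"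
    using cst_pos scale_at_pos [OF r(2), of x] by (intro mult_right_mono) auto
  finally show "ndist n (g x) (g y) \<le> 22 * cst * scale_at x r" .
  have wave_diff: "norm (wave k x - wave k y) \<le> 11 * cst * scale_at x r" for k
  proof (cases "wave k x = 0 \<and> wave k y = 0")
    case True
    then show ?thesis
      using cst_pos scale_at_pos [OF r(2), of x] by simp
  next
    case False
    let ?P = "2 powi k :: real"
    let ?b = "\<lambda>z. bump (\<delta> z / ?P)" and ?a = "\<lambda>z. amplitude k z" and ?e = "\<lambda>z. cis (z / (2 * N * ?P))"
    have P: "0 < ?P" by simp
    have P_bounds: "\<delta> x \<le> 4 * ?P" "?P \<le> 3 * \<delta> x"
      using False wave_support [of k x] wave_support [of k y] \<delta>y \<delta> by argo+
    have scale: "0 \<le> ?P / \<delta> x" "?P / \<delta> x \<le> 3"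
      using P_bounds \<delta> by (auto simp: pos_divide_le_eq)
    have a_bound: "?a z \<le> cst * W" if "\<bar>z - p\<bar> \<le> 2 * \<delta> x" for z
    proof -
      have "?a z \<le> C * \<theta> 6 * \<theta> (?P / \<delta> x) * W"
        unfolding W_def using that by (intro amplitude_le [OF p \<delta>]) auto
      also have "\<dots> \<le> cst * W"
        using scale by (intro times cst_ge) auto
      finally show ?thesis .
    qed
    have ax: "?a x \<le> cst * W" and ay: "?a y \<le> cst * W"
      using xp \<delta> r near by (intro a_bound; argo)+
    have "\<bar>?b x - ?b y\<bar> \<le> 2 * \<bar>\<delta> x / ?P - \<delta> y / ?P\<bar>"
      by (rule bump_lipschitz)
    also have "\<dots> = 2 * (\<bar>\<delta> x - \<delta> y\<bar> / ?P)"
      using P by (simp add: diff_divide_distrib [symmetric])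
    also have "\<dots> \<le> 2 * (r / (\<delta> x / 4))"
      using infdist_lipschitz [of x E y] r P_bounds(1) \<delta> by (intro mult_left_mono frac_le) auto
    finally have \<Delta>b: "\<bar>?b x - ?b y\<bar> \<le> 8 * T"
      by (simp add: T_def)
    have \<Delta>a: "\<bar>?a x - ?a y\<bar> \<le> 2 * T * (cst * W)"
    proof (cases "wt x = wt y")
      case True
      then show ?thesis
        using T W cst_pos by (simp add: amplitude_def gap)
    next
      case ne: False
      have bound: "0 \<le> \<omega> z ?P \<and> \<omega> z ?P \<le> cst * W" if "z \<in> E" "\<bar>p - z\<bar> \<le> 5 * \<delta> x" for z
      proof
        show "0 \<le> \<omega> z ?P"
          using gauge_pos [OF that(1) P] by simp
        have "\<omega> z ?P \<le> C * \<theta> 5 * \<theta> (?P / \<delta> x) * W"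
          unfolding W_def using that(2) by (intro gauge_compare [OF that(1) p P \<delta>]) auto
        also have "\<dots> \<le> cst * W"
          using scale by (intro times cst_ge) auto
        finally show "\<omega> z ?P \<le> cst * W" .
      qed
      have "\<bar>\<omega> (lft x) ?P - \<omega> (rgt x) ?P\<bar> \<le> cst * W"
        using bound [OF lft_mem, of x] bound [OF rgt_mem, of x] ends [OF ne] by argo
      with \<Delta>w show ?thesis
        unfolding amplitude_def gap abs_blend_diff using T by (intro mult_mono) auto
    qed
    have "\<bar>x / (2 * N * ?P) - y / (2 * N * ?P)\<bar> = r / (2 * N * ?P)"
      using N_pos P r(1) by (simp add: diff_divide_distrib [symmetric] abs_divide)
    also have "\<dots> \<le> r / \<delta> x"
    proof -
      have "\<delta> x \<le> 8 * ?P"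
        using P_bounds P by linarith
      also have "\<dots> \<le> 2 * N * ?P"
        using N_ge_4 by (intro mult_right_mono) auto
      finally show ?thesis
        using \<delta> r by (intro divide_left_mono) auto
    qed
    finally have \<Delta>e: "norm (?e x - ?e y) \<le> T"
      using norm_cis_diff_le order_trans unfolding T_def by blast
    have phases: "norm (of_real c * ?e z) = \<bar>c\<bar>" for c z
      by (simp add: norm_mult)
    have 1: "norm (of_real ((?b x - ?b y) * ?a x) * ?e x) \<le> (8 * T) * (cst * W)"
      unfolding phases abs_mult abs_of_nonneg [OF amplitude_pos]
      using \<Delta>b ax T by (intro mult_mono amplitude_pos) auto
    have 2: "norm (of_real (?b y * (?a x - ?a y)) * ?e x) \<le> 1 * (2 * T * (cst * W))"
      unfolding phases abs_mult abs_of_nonneg [OF bump_range(1)]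
      using \<Delta>a by (intro mult_mono bump_range) auto
    have 3: "norm (of_real (?b y * ?a y) * (?e x - ?e y)) \<le> 1 * (cst * W) * T"
      unfolding norm_mult norm_of_real abs_mult abs_of_nonneg [OF bump_range(1)] abs_of_nonneg [OF amplitude_pos]
      using \<Delta>e ay W cst_pos by (intro mult_mono bump_range amplitude_pos mult_nonneg_nonneg) auto
    \<comment> \<open>The product rule for differences: bump, amplitude and phase are changed one after the other.\<close>
    have "wave k x - wave k y = of_real ((?b x - ?b y) * ?a x) * ?e x
        + (of_real (?b y * (?a x - ?a y)) * ?e x + of_real (?b y * ?a y) * (?e x - ?e y))"
      by (simp add: wave_def algebra_simps)
    then have "norm (wave k x - wave k y) \<le> norm (of_real ((?b x - ?b y) * ?a x) * ?e x)
        + (norm (of_real (?b y * (?a x - ?a y)) * ?e x) + norm (of_real (?b y * ?a y) * (?e x - ?e y)))"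
      by (simp only:) (rule norm_triangle_le, rule add_left_mono, rule norm_triangle_ineq)
    also have "\<dots> \<le> (8 * T) * (cst * W) + (1 * (2 * T * (cst * W)) + 1 * (cst * W) * T)"
      by (rule add_mono [OF 1 add_mono [OF 2 3]])
    also have "\<dots> = 11 * cst * scale_at x r"
      by (simp add: scale_at algebra_simps)
    finally show ?thesis .
  qed
  show "norm (h x c - h y c) \<le> 22 * cst * scale_at x r" if "c < K" for c
    using norm_h_diff_le [OF that wave_diff] by simp
qed

lemma separation_upper:
  assumes "x \<noteq> y"
  shows "separation x y \<le> (real K + 1) * (22 * cst * scale_at x \<bar>x - y\<bar>)"
proof (cases "2 * \<bar>x - y\<bar> < \<delta> x")
  case True
  then show ?thesis
    using assms by (intro separation_upper_near) auto
next
  case False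
  then have "separation x y \<le> (real K + 1) * (4 * cst * scale_at x \<bar>x - y\<bar>)"
    using assms by (intro separation_upper_far) auto
  also have "\<dots> \<le> (real K + 1) * (22 * cst * scale_at x \<bar>x - y\<bar>)"
    using cst_pos scale_at_pos [of "\<bar>x - y\<bar>" x] assms by (intro mult_left_mono mult_right_mono) auto
  finally show ?thesis .
qed

text \<open>
  The feet \<open>p\<close> and \<open>q\<close> are at distance between \<open>r / 2\<close> and \<open>2 r\<close>, so their images are at distance
  comparable with the gauge at radius \<open>r\<close>. The errors made by replacing \<open>g\<close> by the images of the feet are
  controlled by \<open>\<theta> (3 / N)\<close>, which the choice of \<open>N\<close> makes small.
\<close>

lemma scale_at_le_far:
  assumes r: "r = \<bar>x - y\<bar>" "0 < r" and far: "N * \<delta> x \<le> r" "N * \<delta> y \<le> r"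
  shows "scale_at x r \<le> 2 * C * \<theta> 2 * ndist n (g x) (g y)"
proof -
  define p where "p = foot x"
  define q where "q = foot y"
  define W where "W = \<omega> p r"
  have p: "p \<in> E" "\<bar>x - p\<bar> = \<delta> x" and q: "q \<in> E" "\<bar>y - q\<bar> = \<delta> y"
    using foot by (simp_all add: p_def q_def)
  have "4 * \<delta> z \<le> N * \<delta> z" for z
    using N_ge_4 infdist_nonneg by (intro mult_right_mono) auto
  from this [of x] this [of y] have small: "4 * \<delta> x \<le> r" "4 * \<delta> y \<le> r"
    using far by linarith+
  have W: "0 < W"
    using gauge_pos [OF p(1) r(2)] by (simp add: W_def)
  have scale_at: "scale_at x r = W"
    using small r(2) infdist_nonneg [of x E] by (simp add: scale_at_def W_def p_def max_def)
  have pq: "r \<le> 2 * \<bar>p - q\<bar>" "\<bar>q - p\<bar> \<le> 2 * r" "p \<noteq> q"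
    using p(2) q(2) small r by argo+
  have "W \<le> \<theta> (r / \<bar>p - q\<bar>) * \<omega> p \<bar>p - q\<bar>"
    unfolding W_def using pq(3) r(2) by (intro gauge_scale p(1)) auto
  also have "\<dots> \<le> \<theta> 2 * (C * ndist n (f p) (f q))"
    using pq r(2) gauge_le_ndist [OF p(1) q(1) pq(3)] gauge_pos [OF p(1), of "\<bar>p - q\<bar>"]
    by (intro mult_mono \<theta>_mono \<theta>_nonneg) (auto simp: pos_divide_le_eq)
  finally have main: "W \<le> C * \<theta> 2 * ndist n (f p) (f q)"
    by (simp add: mult_ac)
  have err: "ndist n (g z) (f e) \<le> C * \<theta> (3 / N) * \<omega> e r"
    if "e \<in> E" "\<bar>z - e\<bar> = \<delta> z" "N * \<delta> z \<le> r" for z e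
  proof -
    have "3 * \<bar>z - e\<bar> / r \<le> 3 / N"
      using that r(2) N_pos by (simp add: field_simps)
    then have "C * \<theta> (3 * \<bar>z - e\<bar> / r) * \<omega> e r \<le> C * \<theta> (3 / N) * \<omega> e r"
      using C_pos gauge_pos [OF that(1) r(2)] r(2)
      by (intro mult_right_mono mult_left_mono \<theta>_mono) auto
    then show ?thesis
      using g_near [OF that(1) r(2), of z] by linarith
  qed
  have "\<omega> q r \<le> C * \<theta> 2 * \<theta> (r / r) * W"
    unfolding W_def using pq by (intro gauge_compare q(1) p(1) r(2)) auto
  then have "\<omega> q r \<le> C * \<theta> 2 * \<theta> 1 * W"
    using r(2) by simp
  then have "C * \<theta> (3 / N) * \<omega> q r \<le> C * \<theta> (3 / N) * (C * \<theta> 2 * \<theta> 1 * W)"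
    using C_pos N_pos \<theta>_nonneg by (intro mult_left_mono) auto
  with err [OF p far(1)] err [OF q far(2)]
  have errs: "ndist n (g x) (f p) + ndist n (g y) (f q) \<le> C * \<theta> (3 / N) * (1 + C * \<theta> 2 * \<theta> 1) * W"
    by (simp add: W_def algebra_simps)
  have "ndist n (f p) (f q) \<le> ndist n (g x) (g y) + (ndist n (g x) (f p) + ndist n (g y) (f q))"
    using ndist_triangle [of "f p" "f q" n "g x"] ndist_triangle [of "g x" "f q" n "g y"]
      ndist_commute [of "f p" "g x" n] by linarith
  then have "C * \<theta> 2 * ndist n (f p) (f q)
      \<le> C * \<theta> 2 * (ndist n (g x) (g y) + C * \<theta> (3 / N) * (1 + C * \<theta> 2 * \<theta> 1) * W)"
    using errs C_pos \<theta>_nonneg [of 2] by (intro mult_left_mono) auto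
  with main have "2 * W \<le> 2 * C * \<theta> 2 * ndist n (g x) (g y)
      + (2 * C * \<theta> 2 * (C * \<theta> (3 / N) * (1 + C * \<theta> 2 * \<theta> 1))) * W"
    by (simp add: algebra_simps)
  also have "\<dots> \<le> 2 * C * \<theta> 2 * ndist n (g x) (g y) + 1 * W"
    using N_large W by (intro add_left_mono mult_right_mono) auto
  finally show ?thesis
    by (simp add: scale_at)
qed

text \<open>
  Let \<open>k\<close> be a scale whose bump at \<open>x\<close> is at least \<open>1 / 2\<close> and \<open>k'\<close> the scale assigned to \<open>y\<close> in the same
  plane. If \<open>k' = k\<close>, then the phases differ by at least \<open>r / (4 N \<delta> x)\<close> and at most \<open>1\<close>. Otherwise
  \<open>\<delta> y \<le> \<delta> x\<close> forces \<open>k' \<le> k - K\<close> unless the wave at \<open>y\<close> vanishes, and this wave is negligible.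
\<close>

lemma wave_separates:
  assumes r: "r = \<bar>x - y\<bar>" "0 < r" and le: "\<delta> y \<le> \<delta> x" and near: "r < N * \<delta> x"
  shows "\<exists>c<K. \<omega> (foot x) (\<delta> x) * (r / \<delta> x) \<le> 32 * N * (C * \<theta> 6 * \<theta> 2) * norm (h x c - h y c)"
proof -
  define p where "p = foot x"
  define W where "W = \<omega> p (\<delta> x)"
  define S where "S = C * \<theta> 6 * \<theta> 2"
  have p: "p \<in> E" "\<bar>x - p\<bar> = \<delta> x"
    using foot by (simp_all add: p_def)
  have \<delta>: "0 < \<delta> x"
    using r near N_pos by (metis less_trans zero_less_mult_pos)
  have W: "0 < W"
    using gauge_pos [OF p(1) \<delta>] by (simp add: W_def)
  have S: "1 \<le> S"
  proof -
    have "1 * 1 * 1 \<le> C * \<theta> 6 * \<theta> 2"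
      using C_ge_1 one_le_\<theta> \<theta>_nonneg by (intro mult_mono) auto
    then show ?thesis by (simp add: S_def)
  qed
  obtain k where k: "1 / 2 \<le> bump (\<delta> x / 2 powi k)"
    using bump_scale_exists [OF \<delta>] .
  let ?P = "2 powi k :: real"
  have P: "0 < ?P" by simp
  have Px: "\<delta> x < 2 * ?P" "?P < 2 * \<delta> x"
    using bump_support [of "\<delta> x / ?P"] k P by (auto simp: pos_less_divide_eq pos_divide_less_eq)
  define A where "A = bump (\<delta> x / ?P) * amplitude k x"
  have "W \<le> C * \<theta> 6 * \<theta> (\<delta> x / ?P) * amplitude k x"
    unfolding W_def using p Px by (intro le_amplitude \<delta>) auto
  also have "\<dots> \<le> S * amplitude k x"
    unfolding S_def using C_pos \<theta>_nonneg \<delta> P Px amplitude_pos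
    by (intro mult_right_mono mult_left_mono \<theta>_mono) (auto simp: pos_divide_le_eq)
  finally have "W \<le> S * amplitude k x" .
  moreover have "(1 / 2) * amplitude k x \<le> A"
    unfolding A_def using k amplitude_pos by (intro mult_right_mono) auto
  then have "S * ((1 / 2) * amplitude k x) \<le> S * A"
    using S by (intro mult_left_mono) auto
  ultimately have A: "W \<le> 2 * (S * A)"
    by simp
  have "0 < S * A"
    using A W by linarith
  then have A_pos: "0 < A"
    using S by (simp add: zero_less_mult_iff)
  have norm_x: "norm (wave k x) = A"
    by (simp add: norm_wave A_def)
  then have wx: "wave k x \<noteq> 0"
    using A_pos by auto
  define c where "c = nat (k mod int K)"
  have c: "c < K" "int c = k mod int K"
    using K_ge_2 by (auto simp: c_def nat_less_iff)
  have hx: "h x c = wave k x"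
    unfolding c_def by (rule h_eq_wave [OF wx])
  define k' where "k' = active_scale c y"
  have hy: "h y c = wave k' y"
    by (simp add: h_def k'_def)
  have T: "0 < r / \<delta> x" "r / \<delta> x \<le> N"
    using r \<delta> near by (auto simp: pos_divide_le_eq)
  have "W * (r / \<delta> x) \<le> 32 * N * S * norm (wave k x - wave k' y)"
  proof (cases "k' = k")
    case True
    let ?e = "\<lambda>z. cis (z / (2 * N * ?P))"
    have phase: "\<bar>x / (2 * N * ?P) - y / (2 * N * ?P)\<bar> = r / (2 * N * ?P)"
      using N_pos P r(1) by (simp add: diff_divide_distrib [symmetric] abs_divide)
    have "r \<le> 2 * N * ?P"
    proof -
      have "N * \<delta> x \<le> N * (2 * ?P)"
        using N_pos Px by (intro mult_left_mono) auto
      with near show ?thesis by simp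
    qed
    then have "r / (2 * N * ?P) \<le> 1"
      using N_pos P by (simp add: pos_divide_le_eq)
    then have e: "r / (2 * N * ?P) / 2 \<le> norm (?e x - ?e y)"
      using norm_cis_diff_ge [of "x / (2 * N * ?P)" "y / (2 * N * ?P)"] unfolding phase by simp
    have "r / (4 * N * \<delta> x) \<le> r / (2 * N * ?P)"
      using r(2) N_pos P Px \<delta> by (intro divide_left_mono) auto
    with e have "A * (r / (4 * N * \<delta> x)) \<le> A * (2 * norm (?e x - ?e y))"
      using A_pos by (intro mult_left_mono) auto
    also have "\<dots> = 4 * (A * norm (?e x - ?e y) / 2)"
      by simp
    also have "\<dots> \<le> 4 * norm (of_real A * ?e x - of_real (bump (\<delta> y / ?P) * amplitude k y) * ?e y)"
      using A_pos bump_range(1) amplitude_pos by (intro mult_left_mono norm_polar_diff_ge) auto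
    also have "of_real A * ?e x - of_real (bump (\<delta> y / ?P) * amplitude k y) * ?e y = wave k x - wave k' y"
      by (simp add: wave_def A_def True)
    finally have step: "A * (r / \<delta> x) \<le> 16 * N * norm (wave k x - wave k' y)"
      using N_pos \<delta> by (simp add: field_simps)
    have "W * (r / \<delta> x) \<le> 2 * (S * A) * (r / \<delta> x)"
      using A T by (intro mult_right_mono) auto
    also have "\<dots> = 2 * S * (A * (r / \<delta> x))"
      by simp
    also have "\<dots> \<le> 2 * S * (16 * N * norm (wave k x - wave k' y))"
      using step S by (intro mult_left_mono) auto
    finally show ?thesis
      by (simp add: mult_ac)
  next
    case False
    have small: "4 * S * norm (wave k' y) \<le> W"
    proof (cases "wave k' y = 0")
      case True
      then show ?thesis using W by simp
    next
      case wy: False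
      let ?P' = "2 powi k' :: real"
      have "?P' < 4 * ?P"
        using wave_support [OF wy] le Px by argo
      then have "k' < k + 2"
        by (rule powi_two_less)
      moreover have "int K \<le> \<bar>k' - k\<bar>"
        using cong_far [of k' k] active_scale(1) [OF c(1), of y] c(2) False by (simp add: k'_def)
      ultimately have "k' + int K \<le> k"
        using K_ge_2 by linarith
      then have "2 powi (k' + int K) \<le> ?P"
        by (intro power_int_increasing) auto
      then have "?P' * 2 ^ K \<le> ?P"
        by (simp add: power_int_add)
      then have "?P' * 2 ^ K \<le> 2 * \<delta> x"
        using Px by linarith
      then have "?P' / \<delta> x \<le> 2 / 2 ^ K"
        using \<delta> by (simp add: field_simps)
      have "norm (wave k' y) \<le> amplitude k' y"
        by (rule norm_wave_le)
      also have "\<dots> \<le> C * \<theta> (3 * (N + 1)) * \<theta> (?P' / \<delta> x) * W"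
        unfolding W_def
      proof (rule amplitude_le [OF p(1) \<delta>])
        have "\<bar>y - p\<bar> \<le> r + \<delta> x"
          using p(2) r(1) by argo
        then show "3 * \<bar>y - p\<bar> \<le> 3 * (N + 1) * \<delta> x"
          using near by (simp add: algebra_simps)
      qed (use N_ge_4 in auto)
      also have "\<dots> \<le> C * \<theta> (3 * (N + 1)) * \<theta> (2 / 2 ^ K) * W"
        using \<open>?P' / \<delta> x \<le> 2 / 2 ^ K\<close> C_pos \<theta>_nonneg N_pos W \<delta>
        by (intro mult_right_mono mult_left_mono \<theta>_mono) auto
      finally have "4 * S * norm (wave k' y) \<le> 4 * S * (C * \<theta> (3 * (N + 1)) * \<theta> (2 / 2 ^ K) * W)"
        using S by (intro mult_left_mono) auto
      also have "\<dots> = (4 * S * (C * \<theta> (3 * (N + 1)) * \<theta> (2 / 2 ^ K))) * W"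
        by simp
      also have "\<dots> \<le> 1 * W"
        using K_large W unfolding S_def by (intro mult_right_mono) auto
      finally show ?thesis by simp
    qed
    have "A - norm (wave k' y) \<le> norm (wave k x - wave k' y)"
      using norm_triangle_ineq2 [of "wave k x" "wave k' y"] norm_x by simp
    then have "4 * S * (A - norm (wave k' y)) \<le> 4 * S * norm (wave k x - wave k' y)"
      using S by (intro mult_left_mono) auto
    then have "W \<le> 4 * S * norm (wave k x - wave k' y)"
      using A small by (simp add: algebra_simps)
    then have "W * (r / \<delta> x) \<le> (4 * S * norm (wave k x - wave k' y)) * N"
      using T W S by (intro mult_mono) auto
    also have "\<dots> \<le> 8 * ((4 * S * norm (wave k x - wave k' y)) * N)"
      using S N_pos by simp
    finally show ?thesis
      by (simp add: mult_ac)
  qed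
  then show ?thesis
    using c(1) unfolding hx [symmetric] hy [symmetric] S_def W_def p_def by blast
qed

text \<open>
  This serves both ends of a near pair, \<open>z = x\<close> and \<open>z = y\<close>, so that the pair may be ordered by the distance
  to \<open>E\<close> although \<open>scale_at\<close> is not symmetric.
\<close>

lemma scale_at_le_near:
  assumes r: "0 < r" and z: "\<bar>x - z\<bar> \<le> r" "\<delta> z \<le> \<delta> x" and near: "r < N * \<delta> x"
  shows "scale_at z r \<le> 2 * (C * \<theta> (N + 2) * \<theta> N) * (\<omega> (foot x) (\<delta> x) * (r / \<delta> x))"
proof -
  let ?m = "max r (\<delta> z)" and ?W = "\<omega> (foot x) (\<delta> x)"
  have \<delta>: "0 < \<delta> x"
    using r near N_pos by (metis less_trans zero_less_mult_pos)
  have W: "0 < ?W"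
    using gauge_pos [OF foot(1) \<delta>] .
  have m: "0 < ?m"
    using r by simp
  have "1 * \<delta> x \<le> N * \<delta> x"
    using N_ge_4 \<delta> by (intro mult_right_mono) auto
  then have m_up: "?m \<le> N * \<delta> x"
    using near z(2) by simp
  have "\<delta> x \<le> \<delta> z + r"
    using infdist_lipschitz [of x E z] z(1) by argo
  then have m_lo: "\<delta> x \<le> 2 * ?m"
    by argo
  have "\<bar>foot z - foot x\<bar> \<le> r + \<delta> z + \<delta> x"
    using foot(2) [of x] foot(2) [of z] z(1) by argo
  then have feet: "\<bar>foot z - foot x\<bar> \<le> (N + 2) * \<delta> x"
    using near z(2) by (simp add: distrib_right)
  have "\<omega> (foot z) ?m \<le> C * \<theta> (N + 2) * \<theta> (?m / \<delta> x) * ?W"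
    using N_pos by (intro gauge_compare foot(1) m \<delta> feet) auto
  also have "\<dots> \<le> C * \<theta> (N + 2) * \<theta> N * ?W"
    using m_up m \<delta> C_pos N_pos \<theta>_nonneg W
    by (intro mult_right_mono mult_left_mono \<theta>_mono) (auto simp: pos_divide_le_eq)
  finally have 1: "\<omega> (foot z) ?m \<le> C * \<theta> (N + 2) * \<theta> N * ?W" .
  have "r / ?m \<le> r / (\<delta> x / 2)"
    using m_lo \<delta> r m by (intro divide_left_mono) auto
  also have "\<dots> = 2 * (r / \<delta> x)"
    by simp
  finally have 2: "r / ?m \<le> 2 * (r / \<delta> x)" .
  have "scale_at z r \<le> (C * \<theta> (N + 2) * \<theta> N * ?W) * (2 * (r / \<delta> x))"
    unfolding scale_at_def using 1 2 r m gauge_pos [OF foot(1) m, of z] C_pos \<theta>_nonneg N_pos W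
    by (intro mult_mono) auto
  then show ?thesis
    by (simp add: mult_ac)
qed

definition extension :: "real \<Rightarrow> nat \<Rightarrow> real" where
  "extension x = assemble n K (g x) (h x)"

lemma scale_at_le_separation:
  assumes "x \<noteq> y"
  shows "scale_at x \<bar>x - y\<bar> \<le> lower_const \<theta> C N * ndist (n + 2 * K) (extension x) (extension y)"
proof -
  let ?r = "\<bar>x - y\<bar>" and ?D = "ndist (n + 2 * K) (extension x) (extension y)"
  let ?c1 = "2 * C * \<theta> 2" and ?c2 = "2 * (C * \<theta> (N + 2) * \<theta> N)" and ?c3 = "32 * N * (C * \<theta> 6 * \<theta> 2)"
  have r: "0 < ?r"
    using assms by simp
  have nn: "0 \<le> ?c1" "0 \<le> ?c2" "0 \<le> ?c3" "0 \<le> ?D"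
    using C_pos \<theta>_nonneg N_pos by simp_all
  have near_case: "scale_at x ?r \<le> ?c2 * (?c3 * ?D)"
    if uv: "\<bar>u - v\<bar> = ?r" "\<delta> v \<le> \<delta> u" "?r < N * \<delta> u" "x = u \<or> x = v"
      and ext: "\<And>c. c < K \<Longrightarrow> norm (h u c - h v c) \<le> ?D" for u v
  proof -
    obtain c where c: "c < K" "\<omega> (foot u) (\<delta> u) * (?r / \<delta> u) \<le> ?c3 * norm (h u c - h v c)"
      using wave_separates [OF uv(1) [symmetric] r uv(2,3)] by blast
    have "?c3 * norm (h u c - h v c) \<le> ?c3 * ?D"
      using ext [OF c(1)] nn by (intro mult_left_mono) auto
    with c(2) have "\<omega> (foot u) (\<delta> u) * (?r / \<delta> u) \<le> ?c3 * ?D"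
      by linarith
    then have "?c2 * (\<omega> (foot u) (\<delta> u) * (?r / \<delta> u)) \<le> ?c2 * (?c3 * ?D)"
      using nn by (intro mult_left_mono) auto
    moreover have "scale_at x ?r \<le> ?c2 * (\<omega> (foot u) (\<delta> u) * (?r / \<delta> u))"
      using uv r by (intro scale_at_le_near) auto
    ultimately show ?thesis by linarith
  qed
  consider "N * \<delta> x \<le> ?r" "N * \<delta> y \<le> ?r" | "\<delta> y \<le> \<delta> x" "?r < N * \<delta> x" | "\<delta> x \<le> \<delta> y" "?r < N * \<delta> y"
  proof (cases "\<delta> y \<le> \<delta> x")
    case True
    then have "N * \<delta> y \<le> N * \<delta> x"
      using N_pos by simp
    then show thesis
      using that True by linarith
  next
    case False
    then have "N * \<delta> x \<le> N * \<delta> y"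
      using N_pos by simp
    then show thesis
      using that False by linarith
  qed
  then have "scale_at x ?r \<le> ?c1 * ?D \<or> scale_at x ?r \<le> ?c2 * (?c3 * ?D)"
  proof cases
    case 1
    have "?c1 * ndist n (g x) (g y) \<le> ?c1 * ?D"
      unfolding extension_def using nn by (intro mult_left_mono ndist_le_ndist_assemble) auto
    then show ?thesis
      using scale_at_le_far [OF refl r 1] by linarith
  next
    case 2
    have "scale_at x ?r \<le> ?c2 * (?c3 * ?D)"
      using 2 unfolding extension_def by (intro near_case [of x y, unfolded extension_def] norm_le_ndist_assemble) auto
    then show ?thesis by blast
  next
    case 3
    have "norm (h y c - h x c) \<le> ?D" if "c < K" for c
      using norm_le_ndist_assemble [OF that, of "h x" "h y" n "g x" "g y"]
      unfolding extension_def by (simp add: norm_minus_commute)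
    then have "scale_at x ?r \<le> ?c2 * (?c3 * ?D)"
      using 3 by (intro near_case [of y x]) (auto simp: abs_minus_commute)
    then show ?thesis by blast
  qed
  moreover note mult_nonneg_nonneg [OF nn(1,4)] mult_nonneg_nonneg [OF nn(2) mult_nonneg_nonneg [OF nn(3,4)]]
  moreover have "lower_const \<theta> C N * ?D = ?c1 * ?D + ?c2 * (?c3 * ?D)"
    by (simp only: lower_const_def distrib_right mult.assoc)
  ultimately show ?thesis
    by linarith
qed

text \<open>
  The comparison of distances with \<open>scale_at x\<close> from both sides has the same centre \<open>x\<close> in numerator and
  denominator, so the quotient is governed by \<open>scale_at_growth\<close>. The summand \<open>t\<close> makes the bound strictly
  increasing and unbounded.
\<close>

theorem qs_bound_extension:
  "qs_bound (\<lambda>t. t + distortion \<theta> C N K * warp 1 \<theta> t) (n + 2 * K) UNIV extension"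
  unfolding qs_bound_def
proof (intro ballI impI conjI)
  fix x a b :: real
  assume ne: "x \<noteq> b"
  let ?D = "\<lambda>u v. ndist (n + 2 * K) (extension u) (extension v)"
  let ?s = "\<bar>x - a\<bar>" and ?t = "\<bar>x - b\<bar>"
  have t: "0 < ?t"
    using ne by simp
  have lower: "scale_at x ?t \<le> lower_const \<theta> C N * ?D x b"
    by (rule scale_at_le_separation [OF ne])
  show pos: "0 < ?D x b"
  proof (rule ccontr)
    assume "\<not> 0 < ?D x b"
    then have "?D x b = 0"
      by (simp add: order_antisym)
    with lower scale_at_pos [OF t, of x] show False
      by simp
  qed
  have warp: "0 \<le> warp 1 \<theta> (?s / ?t)"
    by (rule modulus_nonneg [OF modulus_warp [OF modulus]]) auto
  have const: "0 \<le> (real K + 1) * (22 * cst)"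
    using cst_pos by simp
  show "?D x a \<le> (?s / ?t + distortion \<theta> C N K * warp 1 \<theta> (?s / ?t)) * ?D x b"
  proof (cases "x = a")
    case True
    then show ?thesis
      using modulus_zero [OF modulus_warp [OF modulus, of 1]] by (simp add: L2_set_def)
  next
    case False
    have "?D x a \<le> separation x a"
      unfolding extension_def separation_def by (rule ndist_assemble_le)
    also have "\<dots> \<le> (real K + 1) * (22 * cst) * scale_at x ?s"
      using separation_upper [OF False] by (simp only: mult.assoc)
    also have "\<dots> \<le> (real K + 1) * (22 * cst) * (warp 1 \<theta> (?s / ?t) * (lower_const \<theta> C N * ?D x b))"
    proof (rule mult_left_mono [OF _ const])
      have "scale_at x ?s \<le> warp 1 \<theta> (?s / ?t) * scale_at x ?t"
        using False t by (intro scale_at_growth) auto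
      also have "\<dots> \<le> warp 1 \<theta> (?s / ?t) * (lower_const \<theta> C N * ?D x b)"
        by (rule mult_left_mono [OF lower warp])
      finally show "scale_at x ?s \<le> warp 1 \<theta> (?s / ?t) * (lower_const \<theta> C N * ?D x b)" .
    qed
    also have "\<dots> = (distortion \<theta> C N K * warp 1 \<theta> (?s / ?t)) * ?D x b"
      by (simp add: distortion_def mult_ac)
    also have "\<dots> \<le> (?s / ?t + distortion \<theta> C N K * warp 1 \<theta> (?s / ?t)) * ?D x b"
      using t by (intro mult_right_mono) auto
    finally show ?thesis .
  qed
qed

lemma extension_supported: "n + 2 * K \<le> i \<Longrightarrow> extension x i = 0"
  by (simp add: extension_def assemble_def)

lemma extension_extends:
  assumes x: "x \<in> E" and supp: "\<And>i. n \<le> i \<Longrightarrow> f x i = 0"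
  shows "extension x = f x"
proof -
  have \<delta>: "\<delta> x = 0"
    using x by simp
  have "lft x = x" if "wt x < 1"
    using gap_left_close [OF closed nonempty that] \<delta> by simp
  moreover have "rgt x = x" if "0 < wt x"
    using gap_right_close [OF closed nonempty that] \<delta> by simp
  ultimately have "wt x = 0 \<and> lft x = x \<or> wt x = 1 \<and> rgt x = x \<or> lft x = x \<and> rgt x = x"
    using gap_weight_range [of E x] by argo
  then have "g x = f x"
    by (auto simp: g_def blend_def algebra_simps)
  moreover have "h x c = 0" for c
    by (simp add: h_def wave_def \<delta> bump_def)
  ultimately show ?thesis
    using supp by (auto simp: extension_def assemble_def fun_eq_iff)
qed

end

section \<open>Choice of the parameters\<close>

lemma qs_gauge_mono:
  assumes "qs_gauge \<theta> C n E f \<omega>" "modulus \<theta>'" "\<And>t. 0 \<le> t \<Longrightarrow> \<theta> t \<le> \<theta>' t"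
  shows "qs_gauge \<theta>' C n E f \<omega>"
proof -
  interpret qs_gauge \<theta> C n E f \<omega> by (rule assms(1))
  show ?thesis
  proof
    fix x s t :: real assume *: "x \<in> E" "0 < s" "0 < t"
    have "\<theta> (s / t) * \<omega> x t \<le> \<theta>' (s / t) * \<omega> x t"
      using * gauge_pos [of x t] assms(3) [of "s / t"] by (intro mult_right_mono) auto
    with gauge_scale [OF *] show "\<omega> x s \<le> \<theta>' (s / t) * \<omega> x t"
      by linarith
  qed (rule assms(2) C_ge_1 gauge_pos ndist_le_gauge gauge_le_ndist gauge_centre; assumption)+
qed

text \<open>
  A single point has no image distances to match, so linear growth will do.
\<close>

lemma qs_gauge_singleton:
  assumes "modulus \<theta>" "1 \<le> C" "\<And>t. 0 \<le> t \<Longrightarrow> t \<le> \<theta> t"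
  shows "qs_gauge \<theta> C n {a} f (\<lambda>x r. r)"
proof
  fix x s t :: real assume "0 < s" "0 < t"
  then have "(s / t) * t \<le> \<theta> (s / t) * t"
    using assms(3) by (intro mult_right_mono) auto
  then show "s \<le> \<theta> (s / t) * t"
    using \<open>0 < t\<close> by simp
qed (use assms in auto)

text \<open>
  \<open>N\<close> is chosen first, because the condition on \<open>K\<close> contains \<open>\<theta> (3 * (N + 1))\<close>.
\<close>

lemma extension_parameters_exist:
  assumes \<theta>: "modulus \<theta>" and C: "1 \<le> C"
  obtains N K where "4 \<le> N" "2 \<le> K"
    "2 * C * \<theta> 2 * (C * \<theta> (3 / N) * (1 + C * \<theta> 2 * \<theta> 1)) \<le> 1"
    "4 * (C * \<theta> 6 * \<theta> 2) * (C * \<theta> (3 * (N + 1)) * \<theta> (2 / 2 ^ K)) \<le> 1"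
proof -
  have nn: "0 \<le> \<theta> t" if "0 \<le> t" for t
    using modulus_nonneg [OF \<theta> that] .
  define a where "a = 2 * C * \<theta> 2 * (C * (1 + C * \<theta> 2 * \<theta> 1))"
  have a: "0 \<le> a"
    using C nn by (simp add: a_def)
  obtain d where d: "0 < d" "a * \<theta> d \<le> 1"
    using modulus_small [OF modulus_cmult [OF \<theta> a], of 1] by auto
  define N where "N = max 4 (3 / d)"
  have N: "4 \<le> N" "3 / d \<le> N"
    by (simp_all add: N_def)
  then have "3 / N \<le> d"
    using d(1) by (simp add: field_simps)
  then have "a * \<theta> (3 / N) \<le> a * \<theta> d"
    using a N by (intro mult_left_mono modulus_mono [OF \<theta>]) auto
  with d have N_large: "a * \<theta> (3 / N) \<le> 1"
    by linarith
  define b where "b = 4 * (C * \<theta> 6 * \<theta> 2) * (C * \<theta> (3 * (N + 1)))"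
  have b: "0 \<le> b"
    using C nn N by (simp add: b_def)
  obtain e where e: "0 < e" "b * \<theta> e \<le> 1"
    using modulus_small [OF modulus_cmult [OF \<theta> b], of 1] by auto
  obtain k where k: "2 / e < 2 ^ k"
    using real_arch_pow [of 2 "2 / e"] by auto
  define K where "K = max 2 k"
  have "(2::real) ^ k \<le> 2 ^ K"
    by (intro power_increasing) (auto simp: K_def)
  with k have "2 / e < 2 ^ K"
    by linarith
  then have "2 / 2 ^ K \<le> e"
    using e(1) by (simp add: field_simps)
  then have "b * \<theta> (2 / 2 ^ K) \<le> b * \<theta> e"
    using b by (intro mult_left_mono modulus_mono [OF \<theta>]) auto
  with e have K_large: "b * \<theta> (2 / 2 ^ K) \<le> 1"
    by linarith
  show thesis
  proof (rule that)
    show "4 \<le> N" "2 \<le> K"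
      using N by (simp_all add: K_def)
    show "2 * C * \<theta> 2 * (C * \<theta> (3 / N) * (1 + C * \<theta> 2 * \<theta> 1)) \<le> 1"
      using N_large by (simp add: a_def mult_ac)
    show "4 * (C * \<theta> 6 * \<theta> 2) * (C * \<theta> (3 * (N + 1)) * \<theta> (2 / 2 ^ K)) \<le> 1"
      using K_large by (simp add: b_def mult_ac)
  qed
qed

lemma modulus_distortion_warp:
  assumes \<theta>: "modulus \<theta>" and C: "1 \<le> C" and N: "4 \<le> N"
  shows "modulus (\<lambda>t. distortion \<theta> C N K * warp 1 \<theta> t)"
proof -
  have "0 \<le> \<theta> t" if "0 \<le> t" for t
    using modulus_nonneg [OF \<theta> that] .
  then have "0 \<le> distortion \<theta> C N K"
    using C N by (simp add: distortion_def upper_const_def lower_const_def)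
  then show ?thesis
    by (intro modulus_cmult modulus_warp \<theta>) auto
qed

lemma quasisymmetric_extension_of_gauged:
  assumes ext: "gauge_extension \<theta> C n E f \<omega> N K"
    and supp: "\<And>x i. x \<in> E \<Longrightarrow> n \<le> i \<Longrightarrow> f x i = 0"
  shows "\<exists>F. quasisymmetric (\<lambda>t. t + distortion \<theta> C N K * warp 1 \<theta> t)
      euclidean_metric (euclidean_nspace (n + 2 * K)) F \<and> (\<forall>x\<in>E. F x = f x)"
proof -
  interpret gauge_extension \<theta> C n E f \<omega> N K by (rule ext)
  have "modulus (\<lambda>t. t + distortion \<theta> C N K * warp 1 \<theta> t)"
    by (intro modulus_add modulus_ident modulus_distortion_warp modulus C_ge_1 N_ge_4)
  then have "quasisymmetric (\<lambda>t. t + distortion \<theta> C N K * warp 1 \<theta> t)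
      euclidean_metric (euclidean_nspace (n + 2 * K)) extension"
    using qs_bound_extension extension_supported by (rule quasisymmetric_if_qs_bound)
  then show ?thesis
    using extension_extends supp by blast
qed

theorem theorem1p1:
  fixes M :: real and \<eta> :: "real \<Rightarrow> real"
  assumes "M > 1" and "control_function \<eta>"
  shows "\<exists>n\<^sub>0::nat. \<forall>n::nat. \<exists>\<eta>'. control_function \<eta>' \<and>
    (\<forall>(E::real set) f.
       relatively_connected M (submetric euclidean_metric E) \<and>
       quasisymmetric \<eta> (submetric euclidean_metric E) (euclidean_nspace n) f \<longrightarrow>
       (\<exists>F. quasisymmetric \<eta>' euclidean_metric (euclidean_nspace (n + n\<^sub>0)) F \<and>
            (\<forall>x\<in>E. F x = f x)))"
proof -
  have \<eta>: "modulus \<eta>"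
    by (rule modulus_control_function [OF assms(2)])
  \<comment> \<open>Passing to the closure doubles the constant of relative connectedness.\<close>
  define L where "L = 2 * M"
  have L: "1 \<le> L"
    using assms(1) by (simp add: L_def)
  \<comment> \<open>The summand t lets the same modulus serve sets with at most one point.\<close>
  define \<theta> where "\<theta> t = t + warp (2 * L) \<eta> t" for t
  define C where "C = 1 + 2 * L * \<eta> (2 * L) + 4 * L * (\<eta> (4 * L) + \<eta> (8 * L))"
  have \<theta>: "modulus \<theta>"
    unfolding \<theta>_def using L by (intro modulus_add modulus_ident modulus_warp [OF \<eta>]) auto
  have C: "1 \<le> C"
    using L modulus_nonneg [OF \<eta>] by (simp add: C_def)
  have id_le: "t \<le> \<theta> t" and warp_le: "warp (2 * L) \<eta> t \<le> \<theta> t" if "0 \<le> t" for t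
    using modulus_nonneg [OF modulus_warp [OF \<eta>] that, of "2 * L"] L that by (simp_all add: \<theta>_def)
  obtain N K where NK: "4 \<le> N" "2 \<le> K"
    "2 * C * \<theta> 2 * (C * \<theta> (3 / N) * (1 + C * \<theta> 2 * \<theta> 1)) \<le> 1"
    "4 * (C * \<theta> 6 * \<theta> 2) * (C * \<theta> (3 * (N + 1)) * \<theta> (2 / 2 ^ K)) \<le> 1"
    using extension_parameters_exist [OF \<theta> C] .
  define \<eta>' where "\<eta>' = (\<lambda>t. t + distortion \<theta> C N K * warp 1 \<theta> t)"
  have control: "control_function \<eta>'"
    unfolding \<eta>'_def by (intro control_function_add_modulus modulus_distortion_warp \<theta> C NK(1))
  have extend: "\<exists>F. quasisymmetric \<eta>' euclidean_metric (euclidean_nspace (n + 2 * K)) F \<and> (\<forall>x\<in>E. F x = f x)"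
    if "qs_gauge \<theta> C n E f \<omega>" "closed E" "E \<noteq> {}" "\<And>x i. x \<in> E \<Longrightarrow> n \<le> i \<Longrightarrow> f x i = 0"
    for n f \<omega> and E :: "real set"
    unfolding \<eta>'_def using that NK
    by (intro quasisymmetric_extension_of_gauged gauge_extension.intro gauge_extension_axioms.intro) auto
  have main: "\<exists>F. quasisymmetric \<eta>' euclidean_metric (euclidean_nspace (n + 2 * K)) F \<and> (\<forall>x\<in>E. F x = f x)"
    if rc: "relatively_connected M (submetric euclidean_metric E)"
      and qs: "quasisymmetric \<eta> (submetric euclidean_metric E) (euclidean_nspace n) f" for n f and E :: "real set"
  proof (cases "\<exists>a\<in>E. \<exists>b\<in>E. a \<noteq> b")
    case True
    then obtain a b where two: "a \<in> E" "b \<in> E" "a \<noteq> b"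
      by blast
    obtain f' where f': "\<And>x. x \<in> E \<Longrightarrow> f' x = f x" "qs_bound \<eta> n (closure E) f'"
      "\<And>x i. n \<le> i \<Longrightarrow> f' x i = 0"
      using qs_bound_extends_to_closure [OF \<eta> quasisymmetric_imp_qs_bound [OF qs] two] by blast
    have "annular L (closure E)"
      unfolding L_def using relatively_connected_imp_annular [OF rc] assms(1) by (intro annular_closure) auto
    then obtain \<omega> where "qs_gauge (warp (2 * L) \<eta>) C n (closure E) f' \<omega>"
      using qs_gauge_if_qs_bound [OF \<eta> f'(2) _ L, of a b] two closure_subset [THEN subsetD]
      unfolding C_def by blast
    then have "qs_gauge \<theta> C n (closure E) f' \<omega>"
      using \<theta> warp_le by (rule qs_gauge_mono)
    then have "\<exists>F. quasisymmetric \<eta>' euclidean_metric (euclidean_nspace (n + 2 * K)) F \<and>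
        (\<forall>x\<in>closure E. F x = f' x)"
      using two f'(3) by (intro extend) auto
    then show ?thesis
      using f'(1) closure_subset [THEN subsetD] by metis
  next
    case False
    then obtain a where a: "E \<subseteq> {a}"
      by blast
    define f' where "f' x = (if x \<in> E then f x else (\<lambda>_. 0))" for x
    have "\<exists>F. quasisymmetric \<eta>' euclidean_metric (euclidean_nspace (n + 2 * K)) F \<and> (\<forall>x\<in>{a}. F x = f' x)"
    proof (rule extend)
      show "qs_gauge \<theta> C n {a} f' (\<lambda>x r. r)"
        by (rule qs_gauge_singleton [OF \<theta> C id_le])
      show "f' x i = 0" if "n \<le> i" for x i
        using quasisymmetric_imp_qs_bound(2) [OF qs _ that] by (simp add: f'_def)
    qed simp_all
    then obtain F where F: "quasisymmetric \<eta>' euclidean_metric (euclidean_nspace (n + 2 * K)) F" "F a = f' a"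
      by auto
    have "\<forall>x\<in>E. F x = f x"
      using a F(2) by (auto simp: f'_def)
    with F(1) show ?thesis
      by blast
  qed
  show ?thesis
    using control main by blast
qed

end
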